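(* Let $m,n,p$ be positive integers and let $\mathcal{A}(m,n,p)=\{e_{ij}\otimes e_{jk}\otimes e_{ki}\mid 1\le i\le m,\ 1\le j\le n,\ 1\le k\le p\}$ be the natural algorithm computing $\langle m,n,p\rangle$. Then $$\mathrm{Aut}(\mathcal{A}(m,n,p))=(\mathcal{P}_m\times\mathcal{P}_n\times\mathcal{P}_p)\rtimes Q(m,n,p),$$ where $\mathcal{P}_m\times\mathcal{P}_n\times\mathcal{P}_p$ is regarded as the subgroup $\{T(a,b,c)\mid a\in\mathcal{P}_m,\ b\in\mathcal{P}_n,\ c\in\mathcal{P}_p\}$ of the isotropy group $\Gamma(\langle m,n,p\rangle)$ and the semidirect product is the internal one in $\Gamma(\langle m,n,p\rangle)$.
   Context: All vector spaces are over $\mathbb{C}$; $e_{ij}$ is the matrix (of the appropriate size) with $1$ in position $(i,j)$ and $0$ elsewhere. The matrix multiplication tensor is $\langle m,n,p\rangle=\sum_{i=1}^m\sum_{j=1}^n\sum_{k=1}^p e_{ij}\otimes e_{jk}\otimes e_{ki}\in\mathbb{C}^{m\times n}\otimes\mathbb{C}^{n\times p}\otimes\mathbb{C}^{p\times m}$. Decomposable automorphisms: for $\tilde V=V_1\otimes V_2\otimes V_3$, a decomposable automorphism is a linear automorphism $g$ of $\tilde V$ for which there are a permutation $\sigma\in S_3$ and linear isomorphisms $\varphi_i:V_i\to V_{\sigma(i)}$ such that $g(v_1\otimes v_2\otimes v_3)$ is the decomposable tensor having $\varphi_i(v_i)$ in position $\sigma(i)$. For $t\in\tilde V$, the isotropy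 group $\Gamma(t)$ is the group of all decomposable automorphisms $g$ with $g(t)=t$. An algorithm of length $r$ computing $t$ is a set $\mathcal{A}=\{t_1,\dots,t_r\}$ of decomposable tensors with $t=t_1+\cdots+t_r$; its automorphism group is $\mathrm{Aut}(\mathcal{A})=\{g\in\Gamma(t)\mid g(\mathcal{A})=\mathcal{A}\}$. For $a\in GL_m(\mathbb{C})$, $b\in GL_n(\mathbb{C})$, $c\in GL_p(\mathbb{C})$, $T(a,b,c)\in\Gamma(\langle m,n,p\rangle)$ is defined by $T(a,b,c)(x\otimes y\otimes z)=axb^{-1}\otimes byc^{-1}\otimes cza^{-1}$. $\mathcal{P}_n\subseteq GL_n(\mathbb{C})$ is the group of generalized permutation matrices, i.e. matrices $PD$ with $P$ a permutation matrix and $D$ a nonsingular diagonal matrix. $Q(m,n,p)$ is the following subgroup of $\Gamma(\langle m,n,p\rangle)$, isomorphic to $S_3$, $\mathbb{Z}_2$ or $1$ according to whether $|\{m,n,p\}|$ is $1$, $2$ or $3$. If $m=n=p$, it is generated by $x\otimes y\otimes z\mapsto z\otimes x\otimes y$ and $x\otimes y\otimes z\mapsto y^t\otimes x^t\otimes z^t$. If exactly two of $m,n,p$ coincide, it is generated by the involution $x\otimes y\otimes z\mapsto y^t\otimes x^t\otimes z^t$ (if $m=p$), $x\otimes y\otimes z\mapsto x^t\otimes z^t\otimes y^t$ (if $m=n$), or $x\otimes y\otimes z\mapsto z^t\otimes y^t\otimes x^t$ (if $n=p$). If $m,n,p$ are distinct, it is trivial. *)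

theory Defs
  imports
    "HOL-Algebra.Bij"
    "HOL-Algebra.Generated_Groups"
    "HOL-Algebra.Module"
    "HOL-Combinatorics.Permutations"
    "HOL-Library.Function_Algebras"
    "Jordan_Normal_Form.Matrix"
begin

section \<open>Tensor products of three matrix spaces\<close>

text \<open>
  Rows and columns are numbered from \<open>0\<close>.  A shape \<open>(a, b)\<close> stands for the space of complex
  \<open>a \<times> b\<close> matrices.  For shapes \<open>d 1\<close>, \<open>d 2\<close>, \<open>d 3\<close> the tensor product
  \<open>V\<^sub>1 \<otimes> V\<^sub>2 \<otimes> V\<^sub>3\<close> of the corresponding spaces is realised by coordinate arrays: the value
  \<open>t I J K\<close> is the coefficient of \<open>e\<^sub>I \<otimes> e\<^sub>J \<otimes> e\<^sub>K\<close>, and it is \<open>0\<close> out of range.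
\<close>

type_synonym shape = "nat \<times> nat"
type_synonym tensor = "nat \<times> nat \<Rightarrow> nat \<times> nat \<Rightarrow> nat \<times> nat \<Rightarrow> complex"

definition positions :: "shape \<Rightarrow> (nat \<times> nat) set" where
  "positions s = {..<fst s} \<times> {..<snd s}"

abbreviation mat_space :: "shape \<Rightarrow> (complex, complex mat) module" where
  "mat_space s \<equiv> module_mat TYPE(complex) (fst s) (snd s)"

text \<open>The ring fields \<open>mult\<close> and \<open>one\<close> of a module record are irrelevant for the module structure.\<close>

definition tensor_space :: "(nat \<Rightarrow> shape) \<Rightarrow> (complex, tensor) module" where
  "tensor_space d =
    \<lparr>carrier = {t. \<forall>I J K. t I J K \<noteq> 0 \<longrightarrow>
        I \<in> positions (d 1) \<and> J \<in> positions (d 2) \<and> K \<in> positions (d 3)},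
     monoid.mult = undefined,
     monoid.one = undefined,
     ring.zero = 0,
     ring.add = (+),
     module.smult = (\<lambda>c t I J K. c * t I J K)\<rparr>"

definition entry :: "complex mat \<Rightarrow> nat \<times> nat \<Rightarrow> complex" where
  "entry x I = (if I \<in> positions (dim_row x, dim_col x) then x $$ I else 0)"

definition tprod :: "complex mat \<Rightarrow> complex mat \<Rightarrow> complex mat \<Rightarrow> tensor" where
  "tprod x y z = (\<lambda>I J K. entry x I * entry y J * entry z K)"

definition mat_unit :: "shape \<Rightarrow> nat \<times> nat \<Rightarrow> complex mat" where
  "mat_unit s I = mat (fst s) (snd s) (\<lambda>J. if J = I then 1 else 0)"

text \<open>
  The linear map on \<open>V\<^sub>1 \<otimes> V\<^sub>2 \<otimes> V\<^sub>3\<close> with \<open>x \<otimes> y \<otimes> z \<mapsto> F x y z\<close>, for a trilinear \<open>F\<close>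
  (lemma \<open>lin_ext_tprod\<close> below).
\<close>

definition lin_ext ::
  "(nat \<Rightarrow> shape) \<Rightarrow> (complex mat \<Rightarrow> complex mat \<Rightarrow> complex mat \<Rightarrow> tensor) \<Rightarrow> tensor \<Rightarrow> tensor"
  where
  "lin_ext d F = (\<lambda>u \<in> carrier (tensor_space d). \<lambda>I' J' K'.
     \<Sum>I \<in> positions (d 1). \<Sum>J \<in> positions (d 2). \<Sum>K \<in> positions (d 3).
       u I J K * F (mat_unit (d 1) I) (mat_unit (d 2) J) (mat_unit (d 3) K) I' J' K')"


section \<open>Decomposable automorphisms, isotropy groups, algorithms\<close>

definition linear_iso ::
  "(complex, 'a) module \<Rightarrow> (complex, 'b) module \<Rightarrow> ('a \<Rightarrow> 'b) \<Rightarrow> bool" where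
  "linear_iso M N f \<longleftrightarrow> bij_betw f (carrier M) (carrier N) \<and>
     (\<forall>x \<in> carrier M. \<forall>y \<in> carrier M. f (x \<oplus>\<^bsub>M\<^esub> y) = f x \<oplus>\<^bsub>N\<^esub> f y) \<and>
     (\<forall>c. \<forall>x \<in> carrier M. f (c \<odot>\<^bsub>M\<^esub> x) = c \<odot>\<^bsub>N\<^esub> f x)"

text \<open>
  Automorphisms are extensional functions, as in \<^const>\<open>Bij\<close>, so that equality of functions is
  equality on the tensor space.
\<close>

definition decomposable_auts :: "(nat \<Rightarrow> shape) \<Rightarrow> (tensor \<Rightarrow> tensor) set" where
  "decomposable_auts d =
    {g \<in> extensional (carrier (tensor_space d)).
       linear_iso (tensor_space d) (tensor_space d) g \<and>
       (\<exists>\<sigma> \<phi>. \<sigma> permutes {1, 2, 3::nat} \<and>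
          (\<forall>i \<in> {1, 2, 3}. linear_iso (mat_space (d i)) (mat_space (d (\<sigma> i))) (\<phi> i)) \<and>
          (\<forall>v w. (\<forall>i \<in> {1, 2, 3}. v i \<in> carrier (mat_space (d i)) \<and> w (\<sigma> i) = \<phi> i (v i)) \<longrightarrow>
             g (tprod (v 1) (v 2) (v 3)) = tprod (w 1) (w 2) (w 3)))}"

definition isotropy_group :: "(nat \<Rightarrow> shape) \<Rightarrow> tensor \<Rightarrow> (tensor \<Rightarrow> tensor) monoid" where
  "isotropy_group d t =
    BijGroup (carrier (tensor_space d)) \<lparr>carrier := {g \<in> decomposable_auts d. g t = t}\<rparr>"

definition decomposable_tensors :: "(nat \<Rightarrow> shape) \<Rightarrow> tensor set" where
  "decomposable_tensors d = {tprod x y z | x y z.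
     x \<in> carrier (mat_space (d 1)) \<and> y \<in> carrier (mat_space (d 2)) \<and> z \<in> carrier (mat_space (d 3))}"

definition is_algorithm :: "(nat \<Rightarrow> shape) \<Rightarrow> tensor \<Rightarrow> tensor set \<Rightarrow> bool" where
  "is_algorithm d t A \<longleftrightarrow> finite A \<and> A \<subseteq> decomposable_tensors d \<and> t = \<Sum>A"

definition algorithm_Aut :: "(nat \<Rightarrow> shape) \<Rightarrow> tensor \<Rightarrow> tensor set \<Rightarrow> (tensor \<Rightarrow> tensor) set" where
  "algorithm_Aut d t A = {g \<in> carrier (isotropy_group d t). g ` A = A}"


section \<open>Matrix multiplication\<close>

definition mm_shape :: "nat \<Rightarrow> nat \<Rightarrow> nat \<Rightarrow> nat \<Rightarrow> shape" where
  "mm_shape m n p = (\<lambda>_. (0, 0))(1 := (m, n), 2 := (n, p), 3 := (p, m))"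

definition mm_term :: "nat \<Rightarrow> nat \<Rightarrow> nat \<Rightarrow> nat \<Rightarrow> nat \<Rightarrow> nat \<Rightarrow> tensor" where
  "mm_term m n p i j k =
     tprod (mat_unit (m, n) (i, j)) (mat_unit (n, p) (j, k)) (mat_unit (p, m) (k, i))"

definition mm_tensor :: "nat \<Rightarrow> nat \<Rightarrow> nat \<Rightarrow> tensor" where
  "mm_tensor m n p = (\<Sum>i<m. \<Sum>j<n. \<Sum>k<p. mm_term m n p i j k)"

definition natural_algorithm :: "nat \<Rightarrow> nat \<Rightarrow> nat \<Rightarrow> tensor set" where
  "natural_algorithm m n p = {mm_term m n p i j k | i j k. i < m \<and> j < n \<and> k < p}"

abbreviation mm_isotropy :: "nat \<Rightarrow> nat \<Rightarrow> nat \<Rightarrow> (tensor \<Rightarrow> tensor) monoid" where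
  "mm_isotropy m n p \<equiv> isotropy_group (mm_shape m n p) (mm_tensor m n p)"

abbreviation mat_inv :: "nat \<Rightarrow> complex mat \<Rightarrow> complex mat" where
  "mat_inv n a \<equiv> inv\<^bsub>ring_mat TYPE(complex) n ()\<^esub> a"

definition T_map ::
  "nat \<Rightarrow> nat \<Rightarrow> nat \<Rightarrow> complex mat \<Rightarrow> complex mat \<Rightarrow> complex mat \<Rightarrow> tensor \<Rightarrow> tensor" where
  "T_map m n p a b c = lin_ext (mm_shape m n p) (\<lambda>x y z.
     tprod (a * x * mat_inv n b) (b * y * mat_inv p c) (c * z * mat_inv m a))"

definition permutation_matrix :: "nat \<Rightarrow> complex mat \<Rightarrow> bool" where
  "permutation_matrix n P \<longleftrightarrow>
     (\<exists>\<pi>. \<pi> permutes {..<n} \<and> P = mat n n (\<lambda>(i, j). if i = \<pi> j then 1 else 0))"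

definition gen_perm_mats :: "nat \<Rightarrow> complex mat set" where
  "gen_perm_mats n = {P * D | P D. permutation_matrix n P \<and>
     D \<in> carrier_mat n n \<and> diagonal_mat D \<and> invertible_mat D}"

definition gen_perm_subgroup :: "nat \<Rightarrow> nat \<Rightarrow> nat \<Rightarrow> (tensor \<Rightarrow> tensor) set" where
  "gen_perm_subgroup m n p = {T_map m n p a b c | a b c.
     a \<in> gen_perm_mats m \<and> b \<in> gen_perm_mats n \<and> c \<in> gen_perm_mats p}"

definition Q_generators :: "nat \<Rightarrow> nat \<Rightarrow> nat \<Rightarrow> (tensor \<Rightarrow> tensor) set" where
  "Q_generators m n p = (let L = lin_ext (mm_shape m n p) in
     if m = n \<and> n = p then
       {L (\<lambda>x y z. tprod z x y),
        L (\<lambda>x y z. tprod (transpose_mat y) (transpose_mat x) (transpose_mat z))}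
     else if m = p then {L (\<lambda>x y z. tprod (transpose_mat y) (transpose_mat x) (transpose_mat z))}
     else if m = n then {L (\<lambda>x y z. tprod (transpose_mat x) (transpose_mat z) (transpose_mat y))}
     else if n = p then {L (\<lambda>x y z. tprod (transpose_mat z) (transpose_mat y) (transpose_mat x))}
     else {})"

definition Q_group :: "nat \<Rightarrow> nat \<Rightarrow> nat \<Rightarrow> (tensor \<Rightarrow> tensor) set" where
  "Q_group m n p = generate (mm_isotropy m n p) (Q_generators m n p)"


section \<open>Internal semidirect products\<close>

definition internal_semidirect :: "('a, 'b) monoid_scheme \<Rightarrow> 'a set \<Rightarrow> 'a set \<Rightarrow> 'a set \<Rightarrow> bool"
  where
  "internal_semidirect G K N H \<longleftrightarrow> group G \<and> subgroup K G \<and>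
     N \<lhd> G\<lparr>carrier := K\<rparr> \<and> subgroup H (G\<lparr>carrier := K\<rparr>) \<and>
     N \<inter> H = {\<one>\<^bsub>G\<^esub>} \<and> K = N <#>\<^bsub>G\<^esub> H"


section \<open>The explicit linear maps have the prescribed values on decomposable tensors\<close>

definition mat_linear :: "shape \<Rightarrow> (complex mat \<Rightarrow> complex) \<Rightarrow> bool" where
  "mat_linear s h \<longleftrightarrow>
     (\<forall>x \<in> carrier_mat (fst s) (snd s). \<forall>y \<in> carrier_mat (fst s) (snd s). h (x + y) = h x + h y) \<and>
     (\<forall>c. \<forall>x \<in> carrier_mat (fst s) (snd s). h (c \<cdot>\<^sub>m x) = c * h x)"

lemma finite_positions [simp]: "finite (positions s)"
  by (simp add: positions_def)

lemma mat_unit_carrier [simp]: "mat_unit s I \<in> carrier_mat (fst s) (snd s)"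
  by (simp add: mat_unit_def)

lemma mat_linear_expand:
  assumes h: "mat_linear s h" and x: "x \<in> carrier_mat (fst s) (snd s)"
  shows "h x = (\<Sum>I \<in> positions s. x $$ I * h (mat_unit s I))"
proof -
  define part where "part S = mat (fst s) (snd s) (\<lambda>I. if I \<in> S then x $$ I else 0)" for S
  have [simp]: "part S \<in> carrier_mat (fst s) (snd s)" for S by (simp add: part_def)
  have hadd: "h (u + v) = h u + h v"
    if "u \<in> carrier_mat (fst s) (snd s)" "v \<in> carrier_mat (fst s) (snd s)" for u v
    using h that by (auto simp: mat_linear_def)
  have hsm: "h (c \<cdot>\<^sub>m u) = c * h u" if "u \<in> carrier_mat (fst s) (snd s)" for u c
    using h that by (auto simp: mat_linear_def)
  have "h (part S) = (\<Sum>I \<in> S. x $$ I * h (mat_unit s I))" if "S \<subseteq> positions s" for S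
    using finite_subset[OF that finite_positions] that
  proof (induction S rule: finite_induct)
    case empty
    have "part {} = 0 \<cdot>\<^sub>m part {}" by (rule eq_matI) (auto simp: part_def)
    then have "h (part {}) = 0 * h (part {})" by (metis \<open>part {} \<in> _\<close> hsm)
    then show ?case by simp
  next
    case (insert I S)
    have "part (insert I S) = part S + x $$ I \<cdot>\<^sub>m mat_unit s I"
      using insert.hyps by (intro eq_matI) (auto simp: part_def mat_unit_def)
    then show ?case using insert by (simp add: hadd hsm)
  qed
  moreover have "part (positions s) = x"
    using x by (intro eq_matI) (auto simp: part_def positions_def)
  ultimately show ?thesis by force
qed

lemma tprod_carrier:
  assumes "x \<in> carrier (mat_space (d 1))" "y \<in> carrier (mat_space (d 2))"
    "z \<in> carrier (mat_space (d 3))"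
  shows "tprod x y z \<in> carrier (tensor_space d)"
  using assms
  by (auto simp: tprod_def tensor_space_def entry_def positions_def module_mat_simps split: if_splits)

lemma lin_ext_tprod:
  assumes F1: "\<And>y z I J K. y \<in> carrier (mat_space (d 2)) \<Longrightarrow> z \<in> carrier (mat_space (d 3)) \<Longrightarrow>
      mat_linear (d 1) (\<lambda>x. F x y z I J K)"
    and F2: "\<And>x z I J K. x \<in> carrier (mat_space (d 1)) \<Longrightarrow> z \<in> carrier (mat_space (d 3)) \<Longrightarrow>
      mat_linear (d 2) (\<lambda>y. F x y z I J K)"
    and F3: "\<And>x y I J K. x \<in> carrier (mat_space (d 1)) \<Longrightarrow> y \<in> carrier (mat_space (d 2)) \<Longrightarrow>
      mat_linear (d 3) (\<lambda>z. F x y z I J K)"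
    and x: "x \<in> carrier (mat_space (d 1))" and y: "y \<in> carrier (mat_space (d 2))"
    and z: "z \<in> carrier (mat_space (d 3))"
  shows "lin_ext d F (tprod x y z) = F x y z"
proof (intro ext)
  fix I' J' K'
  have en: "entry u I = u $$ I" if "u \<in> carrier (mat_space s)" "I \<in> positions s" for u I s
    using that by (auto simp: entry_def module_mat_simps positions_def)
  have "F x y z I' J' K' = (\<Sum>I \<in> positions (d 1). x $$ I * F (mat_unit (d 1) I) y z I' J' K')"
    using mat_linear_expand[OF F1[OF y z]] x by (simp add: module_mat_simps)
  also have "\<dots> = (\<Sum>I \<in> positions (d 1). x $$ I * (\<Sum>J \<in> positions (d 2). y $$ J *
      F (mat_unit (d 1) I) (mat_unit (d 2) J) z I' J' K'))"
    by (intro sum.cong refl arg_cong2[where f = "(*)"] mat_linear_expand F2)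
       (use y z in \<open>simp_all add: module_mat_simps\<close>)
  also have "\<dots> = (\<Sum>I \<in> positions (d 1). x $$ I * (\<Sum>J \<in> positions (d 2). y $$ J *
      (\<Sum>K \<in> positions (d 3). z $$ K *
      F (mat_unit (d 1) I) (mat_unit (d 2) J) (mat_unit (d 3) K) I' J' K')))"
    by (intro sum.cong refl arg_cong2[where f = "(*)"] mat_linear_expand F3)
       (use y z in \<open>simp_all add: module_mat_simps\<close>)
  also have "\<dots> = lin_ext d F (tprod x y z) I' J' K'"
    using tprod_carrier[OF x y z]
    by (auto simp: lin_ext_def tprod_def sum_distrib_left mult_ac en[OF x] en[OF y] en[OF z]
        intro!: sum.cong)
  finally show "lin_ext d F (tprod x y z) I' J' K' = F x y z I' J' K'" by simp
qed

lemma mat_linear_entry: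
  assumes "\<And>x. x \<in> carrier_mat (fst s) (snd s) \<Longrightarrow> f x \<in> carrier_mat a b"
    and "\<And>x y. x \<in> carrier_mat (fst s) (snd s) \<Longrightarrow> y \<in> carrier_mat (fst s) (snd s) \<Longrightarrow>
      f (x + y) = f x + f y"
    and "\<And>c x. x \<in> carrier_mat (fst s) (snd s) \<Longrightarrow> f (c \<cdot>\<^sub>m x) = c \<cdot>\<^sub>m f x"
  shows "mat_linear s (\<lambda>x. entry (f x) I)"
proof -
  have "entry (u + v) I = entry u I + entry v I"
    if "u \<in> carrier_mat a b" "v \<in> carrier_mat a b" for u v
    using that by (cases I) (auto simp: entry_def positions_def)
  moreover have "entry (c \<cdot>\<^sub>m u) I = c * entry u I" if "u \<in> carrier_mat a b" for u c
    using that by (cases I) (auto simp: entry_def positions_def)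
  ultimately show ?thesis using assms by (simp add: mat_linear_def)
qed

lemma mat_linear_tprod:
  assumes "\<And>I. mat_linear s (\<lambda>x. entry (f x) I)"
  shows "mat_linear s (\<lambda>x. tprod (f x) u v I J K)"
    and "mat_linear s (\<lambda>x. tprod u (f x) v I J K)"
    and "mat_linear s (\<lambda>x. tprod u v (f x) I J K)"
  using assms by (simp_all add: mat_linear_def tprod_def algebra_simps)

lemma mat_linear_entry_id: "mat_linear s (\<lambda>x. entry x I)"
  by (rule mat_linear_entry[where a = "fst s" and b = "snd s"]) auto

lemma mat_linear_entry_transpose: "mat_linear s (\<lambda>x. entry (transpose_mat x) I)"
  by (rule mat_linear_entry[where a = "snd s" and b = "fst s"]) (auto simp: transpose_add)

lemma mat_linear_entry_mult:
  assumes "a \<in> carrier_mat k (fst s)" "b \<in> carrier_mat (snd s) l"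
  shows "mat_linear s (\<lambda>x. entry (a * x * b) I)"
proof (rule mat_linear_entry[where a = k and b = l])
  show "a * (x + y) * b = a * x * b + a * y * b"
    if "x \<in> carrier_mat (fst s) (snd s)" "y \<in> carrier_mat (fst s) (snd s)" for x y
    using that assms mult_add_distrib_mat[of a k "fst s" x "snd s" y]
      add_mult_distrib_mat[of "a * x" k "snd s" "a * y" b l]
    by simp
  show "a * (c \<cdot>\<^sub>m x) * b = c \<cdot>\<^sub>m (a * x * b)" if "x \<in> carrier_mat (fst s) (snd s)" for c x
    using that assms mult_smult_distrib[of a k "fst s" x "snd s" c]
      mult_smult_assoc_mat[of "a * x" k "snd s" b l c]
    by simp
qed (use assms in auto)

lemmas mat_linear_intros =
  mat_linear_tprod mat_linear_entry_id mat_linear_entry_transpose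

lemma mm_shape_simps [simp]:
  "mm_shape m n p 1 = (m, n)" "mm_shape m n p (Suc 0) = (m, n)"
  "mm_shape m n p 2 = (n, p)" "mm_shape m n p 3 = (p, m)"
  by (simp_all add: mm_shape_def)

lemma mat_inv_carrier:
  assumes "a \<in> Units (ring_mat TYPE(complex) n ())"
  shows "mat_inv n a \<in> carrier_mat n n"
proof -
  interpret semiring "ring_mat TYPE(complex) n ()" by (rule semiring_mat)
  show ?thesis using Units_inv_closed[OF assms] by (simp add: ring_mat_simps)
qed

lemma T_map_tprod:
  assumes "a \<in> Units (ring_mat TYPE(complex) m ())" "b \<in> Units (ring_mat TYPE(complex) n ())"
    "c \<in> Units (ring_mat TYPE(complex) p ())"
    and "x \<in> carrier_mat m n" "y \<in> carrier_mat n p" "z \<in> carrier_mat p m"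
  shows "T_map m n p a b c (tprod x y z) =
    tprod (a * x * mat_inv n b) (b * y * mat_inv p c) (c * z * mat_inv m a)"
proof -
  have "a \<in> carrier_mat m m" "b \<in> carrier_mat n n" "c \<in> carrier_mat p p"
    using assms(1-3) by (auto simp: Units_def ring_mat_simps)
  note carr = this mat_inv_carrier[OF assms(1)] mat_inv_carrier[OF assms(2)]
    mat_inv_carrier[OF assms(3)]
  show ?thesis
    unfolding T_map_def
    by (rule lin_ext_tprod)
       (use carr assms(4-6) in \<open>simp_all add: module_mat_simps mat_linear_tprod
          mat_linear_entry_mult[where k = m and l = n] mat_linear_entry_mult[where k = n and l = p]
          mat_linear_entry_mult[where k = p and l = m]\<close>)
qed

lemma Q_maps_tprod:
  assumes "x \<in> carrier_mat m n" "y \<in> carrier_mat n p" "z \<in> carrier_mat p m"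
  shows "lin_ext (mm_shape m n p) (\<lambda>x y z. tprod z x y) (tprod x y z) = tprod z x y"
    and "lin_ext (mm_shape m n p)
        (\<lambda>x y z. tprod (transpose_mat y) (transpose_mat x) (transpose_mat z)) (tprod x y z) =
      tprod (transpose_mat y) (transpose_mat x) (transpose_mat z)"
    and "lin_ext (mm_shape m n p)
        (\<lambda>x y z. tprod (transpose_mat x) (transpose_mat z) (transpose_mat y)) (tprod x y z) =
      tprod (transpose_mat x) (transpose_mat z) (transpose_mat y)"
    and "lin_ext (mm_shape m n p)
        (\<lambda>x y z. tprod (transpose_mat z) (transpose_mat y) (transpose_mat x)) (tprod x y z) =
      tprod (transpose_mat z) (transpose_mat y) (transpose_mat x)"
proof -
  note 1 = lin_ext_tprod[where d = "mm_shape m n p" and x = x and y = y and z = z]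
  show "lin_ext (mm_shape m n p) (\<lambda>x y z. tprod z x y) (tprod x y z) = tprod z x y"
    by (rule 1) (use assms in \<open>auto intro!: mat_linear_intros simp: module_mat_simps\<close>)
  show "lin_ext (mm_shape m n p)
        (\<lambda>x y z. tprod (transpose_mat y) (transpose_mat x) (transpose_mat z)) (tprod x y z) =
      tprod (transpose_mat y) (transpose_mat x) (transpose_mat z)"
    by (rule 1) (use assms in \<open>auto intro!: mat_linear_intros simp: module_mat_simps\<close>)
  show "lin_ext (mm_shape m n p)
        (\<lambda>x y z. tprod (transpose_mat x) (transpose_mat z) (transpose_mat y)) (tprod x y z) =
      tprod (transpose_mat x) (transpose_mat z) (transpose_mat y)"
    by (rule 1) (use assms in \<open>auto intro!: mat_linear_intros simp: module_mat_simps\<close>)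
  show "lin_ext (mm_shape m n p)
        (\<lambda>x y z. tprod (transpose_mat z) (transpose_mat y) (transpose_mat x)) (tprod x y z) =
      tprod (transpose_mat z) (transpose_mat y) (transpose_mat x)"
    by (rule 1) (use assms in \<open>auto intro!: mat_linear_intros simp: module_mat_simps\<close>)
qed

lemma mm_term_eq:
  assumes "i < m" "j < n" "k < p"
  shows "mm_term m n p i j k =
    (\<lambda>I J K. if I = (i, j) \<and> J = (j, k) \<and> K = (k, i) then 1 else 0)"
  using assms
  by (intro ext) (auto simp: mm_term_def tprod_def entry_def mat_unit_def positions_def split: if_splits)

lemma natural_algorithm_is_algorithm:
  "is_algorithm (mm_shape m n p) (mm_tensor m n p) (natural_algorithm m n p)"
proof -
  let ?B = "{..<m} \<times> {..<n} \<times> {..<p}"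
  let ?f = "\<lambda>(i, j, k). mm_term m n p i j k"
  have nat: "natural_algorithm m n p = ?f ` ?B"
    by (force simp: natural_algorithm_def)
  have "inj_on ?f ?B"
  proof (rule inj_onI, clarsimp)
    fix i j k i' j' k'
    assume *: "i < m" "j < n" "k < p" "i' < m" "j' < n" "k' < p"
      and eq: "mm_term m n p i j k = mm_term m n p i' j' k'"
    have "mm_term m n p i j k (i, j) (j, k) (k, i) = 1" using * by (simp add: mm_term_eq)
    then have "mm_term m n p i' j' k' (i, j) (j, k) (k, i) = 1" using eq by simp
    then show "i = i' \<and> j = j' \<and> k = k'" using * by (simp add: mm_term_eq split: if_splits)
  qed
  then have "mm_tensor m n p = \<Sum>(natural_algorithm m n p)"
    by (simp add: nat sum.reindex mm_tensor_def sum.cartesian_product split_def)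
  moreover have "natural_algorithm m n p \<subseteq> decomposable_tensors (mm_shape m n p)"
    unfolding natural_algorithm_def decomposable_tensors_def mm_term_def
    by (force simp: module_mat_simps mat_unit_def)
  ultimately show ?thesis by (simp add: is_algorithm_def nat)
qed

end

theory Submission
  imports Defs
begin

text \<open>
  An automorphism of the natural algorithm sends \<open>e\<^sub>i\<^sub>j \<otimes> e\<^sub>j\<^sub>k \<otimes> e\<^sub>k\<^sub>i\<close> to a term of the same form, and a
  nonzero decomposable tensor determines its factors up to scalars, so each \<open>\<phi>\<^sub>i\<close> maps matrix
  units to multiples of matrix units, injectively.  Counting them shows which permutations of the
  factors can occur, and \<open>Q(m,n,p)\<close> realizes all of these; hence one may assume that the factors
  stay in place.  Neighbouring factors share an index, which forces
  \<open>e\<^sub>i\<^sub>j \<mapsto> (s\<^sub>i / u\<^sub>j) e\<^sub>\<alpha>\<^sub>i\<^sub>,\<^sub>\<beta>\<^sub>j\<close> and cyclically, i.e. the automorphism is \<open>T(a,b,c)\<close> with generalized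
  permutation matrices.  Normality holds because the \<open>T(a,b,c)\<close> are exactly the automorphisms that
  keep the order of the factors.
\<close>

section \<open>Linear maps on the tensor space\<close>

text \<open>In general the terms of the algorithm span a proper subspace, so a map is not determined
  by its values on them. Maps are therefore compared on all products of three matrix units, with
  unrelated indices, and the information that the terms carry has to be transferred to each factor
  map \<open>\<phi> l\<close> separately. The cyclic matching of indices is then recovered from
  whole terms. Neither the factor maps nor the permutation is determined by an automorphism: the
  former can be rescaled by scalars with product 1, and the permutation is ambiguous when all three
  spaces are one-dimensional. So no homomorphism to the symmetric group is constructed. Its
  substitute is that two automorphisms with a common permutation differ by one that keeps the
  factors in place; this yields normality and the product decomposition alike. The ambiguity matters
  only for the trivial intersection: if m = n = p = 1, every element of Q is the identity, and
  otherwise a factor of dimension at least 2 betrays any nontrivial permutation.\<close>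

abbreviation tscale :: "complex \<Rightarrow> tensor \<Rightarrow> tensor" where
  "tscale c t \<equiv> (\<lambda>I J K. c * t I J K)"

definition tensor_linear :: "(nat \<Rightarrow> shape) \<Rightarrow> (tensor \<Rightarrow> tensor) \<Rightarrow> bool" where
  "tensor_linear d L \<longleftrightarrow> L \<in> extensional (carrier (tensor_space d)) \<and>
     L \<in> carrier (tensor_space d) \<rightarrow> carrier (tensor_space d) \<and>
     (\<forall>s \<in> carrier (tensor_space d). \<forall>t \<in> carrier (tensor_space d). L (s + t) = L s + L t) \<and>
     (\<forall>c. \<forall>t \<in> carrier (tensor_space d). L (tscale c t) = tscale c (L t))"

text \<open>The factors form a function of the position, so that permuting them is composition with
  a permutation of {1, 2, 3}.\<close>

definition tprod3 :: "(nat \<Rightarrow> complex mat) \<Rightarrow> tensor" where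
  "tprod3 v = tprod (v 1) (v 2) (v 3)"

definition factors :: "(nat \<Rightarrow> shape) \<Rightarrow> (nat \<Rightarrow> complex mat) set" where
  "factors d = {v. \<forall>i \<in> {1, 2, 3}. v i \<in> carrier (mat_space (d i))}"

definition indices :: "(nat \<Rightarrow> shape) \<Rightarrow> (nat \<Rightarrow> nat \<times> nat) set" where
  "indices d = {I. \<forall>i \<in> {1, 2, 3}. I i \<in> positions (d i)}"

definition units :: "(nat \<Rightarrow> shape) \<Rightarrow> (nat \<Rightarrow> nat \<times> nat) \<Rightarrow> nat \<Rightarrow> complex mat" where
  "units d I i = mat_unit (d i) (I i)"

definition triple :: "'a \<Rightarrow> 'a \<Rightarrow> 'a \<Rightarrow> nat \<Rightarrow> 'a" where
  "triple x y z i = (if i = 1 then x else if i = 2 then y else z)"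

lemma triple_simps [simp]:
  "triple x y z 1 = x" "triple x y z (Suc 0) = x" "triple x y z 2 = y" "triple x y z 3 = z"
  by (simp_all add: triple_def)

lemma tprod3_triple [simp]: "tprod3 (triple x y z) = tprod x y z"
  by (simp add: tprod3_def)

lemma tprod3_cong:
  assumes "\<And>i. i \<in> {1, 2, 3} \<Longrightarrow> v i = w i"
  shows "tprod3 v = tprod3 w"
  using assms by (simp add: tprod3_def)

lemma mat_space_carrier [simp]: "carrier (mat_space s) = carrier_mat (fst s) (snd s)"
  by (simp add: module_mat_simps)

lemma tensor_space_simps:
  "s \<oplus>\<^bsub>tensor_space d\<^esub> t = s + t" "c \<odot>\<^bsub>tensor_space d\<^esub> t = tscale c t"
  by (simp_all add: tensor_space_def)

lemma tensor_space_add [intro]: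
  "s \<in> carrier (tensor_space d) \<Longrightarrow> t \<in> carrier (tensor_space d) \<Longrightarrow>
    s + t \<in> carrier (tensor_space d)"
  by (simp add: tensor_space_def) (metis add_0)

lemma tensor_space_scale [intro]:
  "t \<in> carrier (tensor_space d) \<Longrightarrow> tscale c t \<in> carrier (tensor_space d)"
  by (auto simp: tensor_space_def)

lemma tensor_space_0 [simp]: "0 \<in> carrier (tensor_space d)"
  by (simp add: tensor_space_def)

lemma tensor_space_sum:
  "(\<And>a. a \<in> A \<Longrightarrow> f a \<in> carrier (tensor_space d)) \<Longrightarrow> sum f A \<in> carrier (tensor_space d)"
  by (induction A rule: infinite_finite_induct) auto

lemma tprod3_carrier [intro]: "v \<in> factors d \<Longrightarrow> tprod3 v \<in> carrier (tensor_space d)"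
  unfolding tprod3_def factors_def by (rule tprod_carrier) auto

lemma units_factors [simp]: "units d I \<in> factors d"
  by (simp add: factors_def units_def)

lemma entry_mat_unit:
  "I \<in> positions s \<Longrightarrow> entry (mat_unit s I) J = (if J = I then 1 else 0)"
  by (cases s; cases I; cases J) (auto simp: entry_def mat_unit_def positions_def split: if_splits)

lemma tprod3_units:
  "I \<in> indices d \<Longrightarrow> tprod3 (units d I) =
    (\<lambda>A B C. if A = I 1 \<and> B = I 2 \<and> C = I 3 then 1 else 0)"
  by (intro ext) (auto simp: tprod3_def tprod_def units_def indices_def entry_mat_unit)

lemma tensor_linear_0: "tensor_linear d L \<Longrightarrow> L 0 = 0"
proof -
  assume L: "tensor_linear d L"
  have "L (tscale 0 0) = tscale 0 (L 0)"
    using L by (simp only: tensor_linear_def tensor_space_0)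
  then show "L 0 = 0" by (simp add: zero_fun_def)
qed

lemma tensor_linear_sum:
  assumes L: "tensor_linear d L" and f: "\<And>a. a \<in> A \<Longrightarrow> f a \<in> carrier (tensor_space d)"
  shows "L (sum f A) = (\<Sum>a \<in> A. L (f a))"
  using f
proof (induction A rule: infinite_finite_induct)
  case (insert a A)
  have "sum f A \<in> carrier (tensor_space d)" using insert by (intro tensor_space_sum) auto
  then have "L (f a + sum f A) = L (f a) + L (sum f A)"
    using L insert.prems unfolding tensor_linear_def by blast
  also have "L (sum f A) = (\<Sum>a \<in> A. L (f a))" using insert by blast
  finally show ?case by (simp only: sum.insert[OF insert.hyps])
qed (simp_all add: tensor_linear_0[OF L])

lemma tensor_linear_eqI:
  assumes L: "tensor_linear d L" and L': "tensor_linear d L'"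
    and eq: "\<And>I. I \<in> indices d \<Longrightarrow> L (tprod3 (units d I)) = L' (tprod3 (units d I))"
  shows "L = L'"
proof (rule extensionalityI)
  show "L \<in> extensional (carrier (tensor_space d))" "L' \<in> extensional (carrier (tensor_space d))"
    using L L' by (simp_all add: tensor_linear_def)
  fix u assume u: "u \<in> carrier (tensor_space d)"
  \<comment> \<open>Truncation of \<open>u\<close> to a set of index triples. Enlarging the set by
    one triple adds one multiple of a product of matrix units, which drives the induction.\<close>
  define part where "part S = (\<lambda>A B C. if (A, B, C) \<in> S then u A B C else 0)" for S
  have part: "part S \<in> carrier (tensor_space d)" for S
    using u by (simp add: part_def tensor_space_def)
  let ?P = "positions (d 1) \<times> positions (d 2) \<times> positions (d 3)"
  have "L (part S) = L' (part S)" if "S \<subseteq> ?P" for S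
    using finite_subset[OF that finite_cartesian_product[OF finite_positions
        finite_cartesian_product[OF finite_positions finite_positions]]] that
  proof (induction S rule: finite_induct)
    case empty
    have "part {} = 0" by (simp add: part_def zero_fun_def)
    then show ?case by (simp only: tensor_linear_0[OF L] tensor_linear_0[OF L'])
  next
    case (insert x S)
    obtain A B C where x: "x = (A, B, C)" by (cases x)
    have I: "triple A B C \<in> indices d" using insert.prems x by (simp add: indices_def)
    let ?e = "tprod3 (units d (triple A B C))"
    have e: "?e \<in> carrier (tensor_space d)" by auto
    have "part (insert x S) = part S + tscale (u A B C) ?e"
      using insert.hyps by (intro ext) (auto simp: part_def tprod3_units[OF I] x)
    moreover have "M (part S + tscale (u A B C) ?e) = M (part S) + tscale (u A B C) (M ?e)"
      if "tensor_linear d M" for M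
      using that part[of S] e tensor_space_scale[OF e, of "u A B C"]
      by (simp add: tensor_linear_def)
    moreover have "L (part S) = L' (part S)" using insert by blast
    ultimately show ?case by (simp only: L L' eq[OF I])
  qed
  moreover have "part ?P = u"
    using u by (intro ext) (auto simp: part_def tensor_space_def simp del: split_paired_All)
  ultimately show "L u = L' u" by force
qed

text \<open>\<open>lin_ext\<close> reads \<open>F\<close> only at matrix units and combines these
  values with the coordinates of the argument as coefficients. It is thus linear whatever
  \<open>F\<close> does elsewhere.\<close>

lemma tensor_linear_lin_ext:
  assumes "\<And>I. I \<in> indices d \<Longrightarrow>
    F (units d I 1) (units d I 2) (units d I 3) \<in> carrier (tensor_space d)"
  shows "tensor_linear d (lin_ext d F)"
proof -
  let ?f = "\<lambda>u I J K. tscale (u I J K) (F (mat_unit (d 1) I) (mat_unit (d 2) J) (mat_unit (d 3) K))"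
  have ap: "(\<Sum>a \<in> A. g a) I J K = (\<Sum>a \<in> A. g a I J K)"
    for A :: "(nat \<times> nat) set" and g :: "_ \<Rightarrow> tensor" and I J K
    by (induction A rule: infinite_finite_induct) auto
  have eq: "lin_ext d F u = (\<Sum>I \<in> positions (d 1). \<Sum>J \<in> positions (d 2). \<Sum>K \<in> positions (d 3). ?f u I J K)"
    if "u \<in> carrier (tensor_space d)" for u
    using that by (intro ext) (simp add: lin_ext_def ap)
  have "?f u I J K \<in> carrier (tensor_space d)"
    if "I \<in> positions (d 1)" "J \<in> positions (d 2)" "K \<in> positions (d 3)" for u I J K
    using assms[of "triple I J K"] that
      by (intro tensor_space_scale) (simp add: units_def indices_def)
  then have "lin_ext d F u \<in> carrier (tensor_space d)" if "u \<in> carrier (tensor_space d)" for u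
    unfolding eq[OF that] by (intro tensor_space_sum)
  moreover have "lin_ext d F (s + t) = lin_ext d F s + lin_ext d F t"
    if "s \<in> carrier (tensor_space d)" "t \<in> carrier (tensor_space d)" for s t
    using that tensor_space_add[OF that]
    by (intro ext) (simp add: lin_ext_def sum.distrib algebra_simps)
  moreover have "lin_ext d F (tscale c t) = tscale c (lin_ext d F t)"
    if "t \<in> carrier (tensor_space d)" for c t
    using that tensor_space_scale[OF that, of c]
    by (intro ext) (simp add: lin_ext_def sum_distrib_left algebra_simps)
  ultimately show ?thesis by (auto simp: tensor_linear_def lin_ext_def)
qed

lemma tensor_linear_compose:
  assumes "tensor_linear d L" "tensor_linear d M"
  shows "tensor_linear d (compose (carrier (tensor_space d)) L M)"
  using assms unfolding tensor_linear_def
  by (auto simp: compose_def tensor_space_add tensor_space_scale Pi_iff)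

lemma tensor_linear_id: "tensor_linear d (\<lambda>x \<in> carrier (tensor_space d). x)"
  by (auto simp: tensor_linear_def tensor_space_add tensor_space_scale)

lemma linear_iso_tensor_space:
  "g \<in> extensional (carrier (tensor_space d)) \<and> linear_iso (tensor_space d) (tensor_space d) g \<longleftrightarrow>
    tensor_linear d g \<and> bij_betw g (carrier (tensor_space d)) (carrier (tensor_space d))"
  by (auto simp: linear_iso_def tensor_linear_def tensor_space_simps dest: bij_betwE)

text \<open>Both composites are linear and agree with the identity on products of matrix units, so
  \<open>tensor_linear_eqI\<close> turns two checks on units into mutual inverses on the whole
  space.\<close>

lemma tensor_linear_bij:
  assumes L: "tensor_linear d L" and M: "tensor_linear d M"
    and "\<And>I. I \<in> indices d \<Longrightarrow> L (M (tprod3 (units d I))) = tprod3 (units d I)"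
    and "\<And>I. I \<in> indices d \<Longrightarrow> M (L (tprod3 (units d I))) = tprod3 (units d I)"
  shows "bij_betw L (carrier (tensor_space d)) (carrier (tensor_space d))"
proof -
  let ?C = "carrier (tensor_space d)"
  have LM: "compose ?C L M = (\<lambda>x \<in> ?C. x)" "compose ?C M L = (\<lambda>x \<in> ?C. x)"
    by (rule tensor_linear_eqI[OF tensor_linear_compose tensor_linear_id];
        use assms in \<open>simp add: compose_eq tprod3_carrier\<close>)+
  have 1: "L (M x) = x \<and> M (L x) = x" if "x \<in> ?C" for x
    using fun_cong[OF LM(1), of x] fun_cong[OF LM(2), of x] that by (simp add: compose_def)
  show ?thesis
    by (rule bij_betw_byWitness[where f' = M])
       (use 1 L M in \<open>auto simp: tensor_linear_def\<close>)
qed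

text \<open>At the positions given by \<open>I\<close> the three entries have product 1, so none is
  zero. Keeping two factors at these positions isolates the entries of the third, which must vanish
  everywhere else.\<close>

lemma tprod3_eq_unitsE:
  assumes eq: "tprod3 w = tprod3 (units d I)" and w: "w \<in> factors d" and I: "I \<in> indices d"
  obtains c where "\<And>i. i \<in> {1, 2, 3} \<Longrightarrow> c i \<noteq> 0 \<and> w i = c i \<cdot>\<^sub>m units d I i"
    and "c 1 * c 2 * c 3 = 1"
proof -
  define c where "c i = entry (w i) (I i)" for i
  have e: "entry (w 1) A * entry (w 2) B * entry (w 3) C =
      (if A = I 1 \<and> B = I 2 \<and> C = I 3 then 1 else 0)" for A B C
    using fun_cong[OF fun_cong[OF fun_cong[OF eq]], of A B C]
    unfolding tprod3_units[OF I] by (simp only: tprod3_def tprod_def)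
  have c: "c 1 * c 2 * c 3 = 1" using e[of "I 1" "I 2" "I 3"] by (simp add: c_def)
  have off: "entry (w i) A = (if A = I i then c i else 0)" if "i \<in> {1, 2, 3}" for i A
    using that e[of A "I 2" "I 3"] e[of "I 1" A "I 3"] e[of "I 1" "I 2" A] c
    by (auto simp: c_def split: if_splits)
  have "c i \<noteq> 0 \<and> w i = c i \<cdot>\<^sub>m units d I i" if i: "i \<in> {1, 2, 3}" for i
  proof
    show "c i \<noteq> 0" using c i by auto
    have dim: "w i \<in> carrier_mat (fst (d i)) (snd (d i))" using w i by (auto simp: factors_def)
    show "w i = c i \<cdot>\<^sub>m units d I i"
    proof (rule eq_matI)
      fix r s assume "r < dim_row (c i \<cdot>\<^sub>m units d I i)" "s < dim_col (c i \<cdot>\<^sub>m units d I i)"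
      then show "w i $$ (r, s) = (c i \<cdot>\<^sub>m units d I i) $$ (r, s)"
        using off[OF i, of "(r, s)"] dim
        by (simp add: units_def mat_unit_def entry_def positions_def split: if_splits)
    qed (use dim in \<open>simp_all add: units_def mat_unit_def\<close>)
  qed
  then show ?thesis using c that by blast
qed

lemma tprod3_scale:
  assumes "\<And>i. i \<in> {1, 2, 3} \<Longrightarrow> w i = c i \<cdot>\<^sub>m units d I i" and I: "I \<in> indices d"
  shows "tprod3 w = tscale (c 1 * c 2 * c 3) (tprod3 (units d I))"
proof -
  have "entry (a \<cdot>\<^sub>m x) A = a * entry x A" for a x A
    by (cases A) (simp add: entry_def positions_def)
  then show ?thesis using assms(1) by (intro ext) (simp add: tprod3_def tprod_def)
qed

lemma smult_unit_eqD:
  assumes eq: "a \<cdot>\<^sub>m mat_unit s I = b \<cdot>\<^sub>m mat_unit s J"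
    and "a \<noteq> 0" "I \<in> positions s" "J \<in> positions s"
  shows "I = J"
proof -
  have "(a \<cdot>\<^sub>m mat_unit s I) $$ I = (b \<cdot>\<^sub>m mat_unit s J) $$ I" by (simp add: eq)
  then show ?thesis using assms(2-)
    by (cases I) (auto simp: mat_unit_def positions_def split: if_splits)
qed

section \<open>Decomposable automorphisms\<close>

text \<open>The \<open>\<rho>\<close> below is the inverse of the \<open>\<sigma>\<close> in \<^const>\<open>decomposable_auts\<close>: position \<open>j\<close> of the image is
  filled from position \<open>\<rho> j\<close>.\<close>

definition decomposes :: "(nat \<Rightarrow> shape) \<Rightarrow> (nat \<Rightarrow> nat) \<Rightarrow> (nat \<Rightarrow> complex mat \<Rightarrow> complex mat) \<Rightarrow>
    (tensor \<Rightarrow> tensor) \<Rightarrow> bool" where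
  "decomposes d \<rho> \<phi> g \<longleftrightarrow> tensor_linear d g \<and>
     bij_betw g (carrier (tensor_space d)) (carrier (tensor_space d)) \<and> \<rho> permutes {1, 2, 3} \<and>
     (\<forall>j \<in> {1, 2, 3}. linear_iso (mat_space (d (\<rho> j))) (mat_space (d j)) (\<phi> j)) \<and>
     (\<forall>v \<in> factors d. g (tprod3 v) = tprod3 (\<lambda>j. \<phi> j (v (\<rho> j))))"

lemma permutes_3: "\<rho> permutes {1, 2, 3::nat} \<Longrightarrow> j \<in> {1, 2, 3} \<Longrightarrow> \<rho> j \<in> {1, 2, 3}"
  using permutes_in_image by metis

text \<open>Naming the source of each position instead of its target replaces the implicit condition
  on \<open>w\<close> by an explicit formula for the image, with which all later computations can
  rewrite.\<close>

lemma decomposable_auts_iff: "g \<in> decomposable_auts d \<longleftrightarrow> (\<exists>\<rho> \<phi>. decomposes d \<rho> \<phi> g)"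
proof
  assume "g \<in> decomposable_auts d"
  then obtain \<sigma> \<phi> where lin: "g \<in> extensional (carrier (tensor_space d))"
      "linear_iso (tensor_space d) (tensor_space d) g"
    and \<sigma>: "\<sigma> permutes {1, 2, 3::nat}"
    and \<phi>: "\<And>i. i \<in> {1, 2, 3} \<Longrightarrow> linear_iso (mat_space (d i)) (mat_space (d (\<sigma> i))) (\<phi> i)"
    and g: "\<And>v w. (\<forall>i \<in> {1, 2, 3}. v i \<in> carrier (mat_space (d i)) \<and> w (\<sigma> i) = \<phi> i (v i)) \<Longrightarrow>
        g (tprod (v 1) (v 2) (v 3)) = tprod (w 1) (w 2) (w 3)"
    unfolding decomposable_auts_def by blast
  let ?\<rho> = "inv_into UNIV \<sigma>"
  have \<rho>: "?\<rho> permutes {1, 2, 3}" using \<sigma> by (rule permutes_inv)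
  have \<sigma>\<rho>: "\<sigma> (?\<rho> j) = j" "?\<rho> (\<sigma> j) = j" for j using permutes_inverses[OF \<sigma>] by auto
  have "decomposes d ?\<rho> (\<lambda>j. \<phi> (?\<rho> j)) g"
    unfolding decomposes_def
  proof (intro conjI ballI)
    show "linear_iso (mat_space (d (?\<rho> j))) (mat_space (d j)) (\<phi> (?\<rho> j))" if "j \<in> {1, 2, 3}" for j
      using \<phi>[OF permutes_3[OF \<rho> that]] by (simp only: \<sigma>\<rho>)
    show "g (tprod3 v) = tprod3 (\<lambda>j. \<phi> (?\<rho> j) (v (?\<rho> j)))" if "v \<in> factors d" for v
      unfolding tprod3_def by (rule g) (use that in \<open>auto simp: factors_def \<sigma>\<rho>\<close>)
  qed (use lin \<rho> linear_iso_tensor_space[of g d] in auto)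
  then show "\<exists>\<rho> \<phi>. decomposes d \<rho> \<phi> g" by blast
next
  assume "\<exists>\<rho> \<phi>. decomposes d \<rho> \<phi> g"
  then obtain \<rho> \<phi> where g: "decomposes d \<rho> \<phi> g" by blast
  then have \<rho>: "\<rho> permutes {1, 2, 3}" by (simp add: decomposes_def)
  let ?\<sigma> = "inv_into UNIV \<rho>"
  have \<sigma>: "?\<sigma> permutes {1, 2, 3}" using \<rho> by (rule permutes_inv)
  have \<sigma>\<rho>: "?\<sigma> (\<rho> j) = j" "\<rho> (?\<sigma> j) = j" for j using permutes_inverses[OF \<rho>] by auto
  have "linear_iso (mat_space (d i)) (mat_space (d (?\<sigma> i))) (\<phi> (?\<sigma> i))" if "i \<in> {1, 2, 3}" for i
  proof -
    have "linear_iso (mat_space (d (\<rho> (?\<sigma> i)))) (mat_space (d (?\<sigma> i))) (\<phi> (?\<sigma> i))"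
      using g permutes_3[OF \<sigma> that] unfolding decomposes_def by blast
    then show ?thesis by (simp only: \<sigma>\<rho>)
  qed
  moreover have "g (tprod (v 1) (v 2) (v 3)) = tprod (w 1) (w 2) (w 3)"
    if vw: "\<forall>i \<in> {1, 2, 3}. v i \<in> carrier (mat_space (d i)) \<and> w (?\<sigma> i) = \<phi> (?\<sigma> i) (v i)" for v w
  proof -
    have "v \<in> factors d" using vw by (simp add: factors_def)
    then have "g (tprod3 v) = tprod3 (\<lambda>j. \<phi> j (v (\<rho> j)))" using g by (simp add: decomposes_def)
    also have "\<dots> = tprod3 w"
    proof (rule tprod3_cong)
      fix j :: nat assume "j \<in> {1, 2, 3}"
      then have "w (?\<sigma> (\<rho> j)) = \<phi> (?\<sigma> (\<rho> j)) (v (\<rho> j))" using vw permutes_3[OF \<rho>] by blast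
      then show "\<phi> j (v (\<rho> j)) = w j" by (simp only: \<sigma>\<rho>)
    qed
    finally show ?thesis by (simp add: tprod3_def)
  qed
  moreover have "g \<in> extensional (carrier (tensor_space d)) \<and>
      linear_iso (tensor_space d) (tensor_space d) g"
    using g linear_iso_tensor_space[of g d] by (simp add: decomposes_def)
  ultimately show "g \<in> decomposable_auts d"
    using \<sigma> unfolding decomposable_auts_def
    by (intro CollectI conjI exI[of _ ?\<sigma>] exI[of _ "\<lambda>i. \<phi> (?\<sigma> i)"]) blast+
qed

lemma linear_iso_compose:
  "linear_iso L M f \<Longrightarrow> linear_iso M N g \<Longrightarrow> linear_iso L N (\<lambda>x. g (f x))"
  unfolding linear_iso_def using bij_betw_trans[of f "carrier L" "carrier M" g "carrier N"]
  by (simp add: o_def bij_betw_apply[of f "carrier L" "carrier M"])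

text \<open>\<open>linear_iso\<close> speaks only about the operations of the two records, so
  closure of the source is a hypothesis here in place of a module structure.\<close>

lemma linear_iso_inv:
  assumes f: "linear_iso M N f"
    and cl: "\<And>x y. x \<in> carrier M \<Longrightarrow> y \<in> carrier M \<Longrightarrow> x \<oplus>\<^bsub>M\<^esub> y \<in> carrier M"
      "\<And>c x. x \<in> carrier M \<Longrightarrow> c \<odot>\<^bsub>M\<^esub> x \<in> carrier M"
  shows "linear_iso N M (inv_into (carrier M) f)"
proof -
  let ?h = "inv_into (carrier M) f"
  have bij: "bij_betw f (carrier M) (carrier N)" using f by (simp add: linear_iso_def)
  have h: "?h y \<in> carrier M" "f (?h y) = y" if "y \<in> carrier N" for y
    using bij that bij_betw_inv_into_right[OF bij] bij_betwE[OF bij_betw_inv_into[OF bij]] by auto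
  have hf: "?h (f x) = x" if "x \<in> carrier M" for x
    using bij_betw_inv_into_left[OF bij that] .
  have "?h (x \<oplus>\<^bsub>N\<^esub> y) = ?h x \<oplus>\<^bsub>M\<^esub> ?h y" if "x \<in> carrier N" "y \<in> carrier N" for x y
  proof -
    have "f (?h x \<oplus>\<^bsub>M\<^esub> ?h y) = x \<oplus>\<^bsub>N\<^esub> y" using f h that by (simp add: linear_iso_def)
    then show ?thesis using hf[OF cl(1)[OF h(1)[OF that(1)] h(1)[OF that(2)]]] by simp
  qed
  moreover have "?h (c \<odot>\<^bsub>N\<^esub> x) = c \<odot>\<^bsub>M\<^esub> ?h x" if "x \<in> carrier N" for c x
  proof -
    have "f (c \<odot>\<^bsub>M\<^esub> ?h x) = c \<odot>\<^bsub>N\<^esub> x" using f h that by (simp add: linear_iso_def)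
    then show ?thesis using hf[OF cl(2)[OF h(1)[OF that]], of c] by simp
  qed
  ultimately show ?thesis using bij_betw_inv_into[OF bij] by (simp add: linear_iso_def)
qed

lemma decomposes_factors:
  assumes "decomposes d \<rho> \<phi> g" "v \<in> factors d"
  shows "(\<lambda>j. \<phi> j (v (\<rho> j))) \<in> factors d"
  unfolding factors_def
proof (rule CollectI, rule ballI)
  fix j :: nat assume j: "j \<in> {1, 2, 3}"
  have "bij_betw (\<phi> j) (carrier (mat_space (d (\<rho> j)))) (carrier (mat_space (d j)))"
    using assms(1) j unfolding decomposes_def linear_iso_def by blast
  moreover have "v (\<rho> j) \<in> carrier (mat_space (d (\<rho> j)))"
    using assms permutes_3[of \<rho> j] j unfolding factors_def decomposes_def by blast
  ultimately show "\<phi> j (v (\<rho> j)) \<in> carrier (mat_space (d j))" by (rule bij_betw_apply)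
qed

text \<open>Sources compose contravariantly: position \<open>j\<close> after \<open>h\<close> comes
  from position \<open>\<tau> j\<close> after \<open>g\<close>, and that one from
  \<open>\<rho> (\<tau> j)\<close>.\<close>

lemma decomposes_compose:
  assumes g: "decomposes d \<rho> \<phi> g" and h: "decomposes d \<tau> \<psi> h"
  shows "decomposes d (\<rho> \<circ> \<tau>) (\<lambda>j x. \<psi> j (\<phi> (\<tau> j) x)) (compose (carrier (tensor_space d)) h g)"
proof -
  have \<rho>: "\<rho> permutes {1, 2, 3}" and \<tau>: "\<tau> permutes {1, 2, 3}"
    using g h by (simp_all add: decomposes_def)
  have "linear_iso (mat_space (d ((\<rho> \<circ> \<tau>) j))) (mat_space (d j)) (\<lambda>x. \<psi> j (\<phi> (\<tau> j) x))"
    if "j \<in> {1, 2, 3}" for j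
  proof (rule linear_iso_compose[where f = "\<phi> (\<tau> j)" and g = "\<psi> j"])
    show "linear_iso (mat_space (d ((\<rho> \<circ> \<tau>) j))) (mat_space (d (\<tau> j))) (\<phi> (\<tau> j))"
      using g permutes_3[OF \<tau> that] by (simp only: decomposes_def o_apply)
    show "linear_iso (mat_space (d (\<tau> j))) (mat_space (d j)) (\<psi> j)"
      using h that by (simp only: decomposes_def)
  qed
  moreover have "compose (carrier (tensor_space d)) h g (tprod3 v) =
      tprod3 (\<lambda>j. \<psi> j (\<phi> (\<tau> j) (v ((\<rho> \<circ> \<tau>) j))))" if v: "v \<in> factors d" for v
    using g h v decomposes_factors[OF g v] by (simp add: compose_eq tprod3_carrier decomposes_def)
  moreover have "tensor_linear d (compose (carrier (tensor_space d)) h g)"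
    "bij_betw (compose (carrier (tensor_space d)) h g) (carrier (tensor_space d)) (carrier (tensor_space d))"
    using g h bij_betw_compose[of g "carrier (tensor_space d)" "carrier (tensor_space d)" h]
    by (simp_all add: decomposes_def tensor_linear_compose)
  ultimately show ?thesis
    unfolding decomposes_def using permutes_compose[OF \<tau> \<rho>] by (intro conjI ballI)
qed

lemma decomposes_inv:
  assumes g: "decomposes d \<rho> \<phi> g"
  obtains \<psi> where
    "decomposes d (inv_into UNIV \<rho>) \<psi> (\<lambda>x \<in> carrier (tensor_space d). inv_into (carrier (tensor_space d)) g x)"
proof
  let ?C = "carrier (tensor_space d)"
    and ?h = "\<lambda>x \<in> carrier (tensor_space d). inv_into (carrier (tensor_space d)) g x"
  \<comment> \<open>The map that takes its input from position \<open>j\<close> is the one filling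
    position \<open>inv_into UNIV \<rho> j\<close>; this is the map to be undone.\<close>
  define \<psi> where "\<psi> j = inv_into (carrier (mat_space (d j))) (\<phi> (inv_into UNIV \<rho> j))" for j
  have \<rho>: "\<rho> permutes {1, 2, 3}" and bij: "bij_betw g ?C ?C" using g
    by (simp_all add: decomposes_def)
  have \<sigma>: "inv_into UNIV \<rho> permutes {1, 2, 3}" using \<rho> by (rule permutes_inv)
  have \<sigma>\<rho>: "inv_into UNIV \<rho> (\<rho> j) = j" "\<rho> (inv_into UNIV \<rho> j) = j" for j
    using permutes_inverses[OF \<rho>] by auto
  have \<phi>: "linear_iso (mat_space (d j)) (mat_space (d (inv_into UNIV \<rho> j))) (\<phi> (inv_into UNIV \<rho> j))"
    if "j \<in> {1, 2, 3}" for j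
  proof -
    have "linear_iso (mat_space (d (\<rho> (inv_into UNIV \<rho> j)))) (mat_space (d (inv_into UNIV \<rho> j))) (\<phi> (inv_into UNIV \<rho> j))"
      using g permutes_3[OF \<sigma> that] unfolding decomposes_def by blast
    then show ?thesis by (simp only: \<sigma>\<rho>)
  qed
  have \<psi>: "linear_iso (mat_space (d (inv_into UNIV \<rho> j))) (mat_space (d j)) (\<psi> j)"
    if "j \<in> {1, 2, 3}" for j
    unfolding \<psi>_def by (rule linear_iso_inv[OF \<phi>[OF that]]) (simp_all add: module_mat_simps)
  have "linear_iso (tensor_space d) (tensor_space d) g"
    using g linear_iso_tensor_space[of g d] by (simp add: decomposes_def)
  then have "linear_iso (tensor_space d) (tensor_space d) (inv_into ?C g)"
    by (rule linear_iso_inv) (auto simp: tensor_space_simps)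
  then have "linear_iso (tensor_space d) (tensor_space d) ?h"
    using bij_betw_cong[of ?C ?h "inv_into ?C g" ?C]
    by (simp add: linear_iso_def tensor_space_simps tensor_space_add tensor_space_scale)
  then have h: "tensor_linear d ?h" "bij_betw ?h ?C ?C"
    using linear_iso_tensor_space[of ?h d] by auto
  have "?h (tprod3 w) = tprod3 (\<lambda>j. \<psi> j (w (inv_into UNIV \<rho> j)))" if w: "w \<in> factors d" for w
  proof -
    let ?v = "\<lambda>j. \<psi> j (w (inv_into UNIV \<rho> j))"
    have v: "?v \<in> factors d"
      unfolding factors_def
    proof (rule CollectI, rule ballI)
      fix j :: nat assume j: "j \<in> {1, 2, 3}"
      show "\<psi> j (w (inv_into UNIV \<rho> j)) \<in> carrier (mat_space (d j))"
        by (rule bij_betw_apply[of _ "carrier (mat_space (d (inv_into UNIV \<rho> j)))"])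
           (use \<psi>[OF j] w permutes_3[OF \<sigma> j] in \<open>auto simp: linear_iso_def factors_def\<close>)
    qed
    have "g (tprod3 ?v) = tprod3 (\<lambda>j. \<phi> j (?v (\<rho> j)))" using g v by (simp add: decomposes_def)
    also have "\<dots> = tprod3 w"
    proof (rule tprod3_cong)
      fix j :: nat assume j: "j \<in> {1, 2, 3}"
      have "bij_betw (\<phi> j) (carrier (mat_space (d (\<rho> j)))) (carrier (mat_space (d j)))"
        using g j unfolding decomposes_def linear_iso_def by blast
      moreover have "w j \<in> carrier (mat_space (d j))" using w j unfolding factors_def by blast
      ultimately have "\<phi> j (inv_into (carrier (mat_space (d (\<rho> j)))) (\<phi> j) (w j)) = w j"
        by (rule bij_betw_inv_into_right)
      then show "\<phi> j (?v (\<rho> j)) = w j" by (simp only: \<psi>_def \<sigma>\<rho>)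
    qed
    finally show ?thesis
      using bij_betw_inv_into_left[OF bij tprod3_carrier[OF v]] tprod3_carrier[OF w] by auto
  qed
  then show "decomposes d (inv_into UNIV \<rho>) \<psi> ?h"
    using h \<sigma> \<psi> unfolding decomposes_def by blast
qed

lemma decomposes_id: "decomposes d id (\<lambda>_ x. x) (\<lambda>x \<in> carrier (tensor_space d). x)"
proof -
  have "linear_iso (mat_space s) (mat_space s) (\<lambda>x. x)" for s
    using bij_betw_id by (simp add: linear_iso_def id_def)
  moreover have "bij_betw (\<lambda>x \<in> S. x) S S" for S
    by (rule bij_betw_byWitness[where f' = "\<lambda>x. x"]) auto
  ultimately show ?thesis
    by (simp add: decomposes_def tensor_linear_id permutes_id tprod3_carrier)
qed

section \<open>Isotropy groups and automorphism groups of algorithms\<close>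

lemma isotropy_group_simps:
  "carrier (isotropy_group d t) = {g \<in> decomposable_auts d. g t = t}"
  "monoid.mult (isotropy_group d t) = monoid.mult (BijGroup (carrier (tensor_space d)))"
  "monoid.one (isotropy_group d t) = (\<lambda>x \<in> carrier (tensor_space d). x)"
  by (simp_all add: isotropy_group_def BijGroup_def)

lemma decomposes_Bij: "decomposes d \<rho> \<phi> g \<Longrightarrow> g \<in> Bij (carrier (tensor_space d))"
  by (simp add: decomposes_def tensor_linear_def Bij_def)

lemma isotropy_carrierE:
  assumes "g \<in> carrier (isotropy_group d t)"
  obtains \<rho> \<phi> where "decomposes d \<rho> \<phi> g" "g t = t"
  using assms by (auto simp: isotropy_group_simps decomposable_auts_iff)

lemma isotropy_mult:
  assumes "h \<in> carrier (isotropy_group d t)" "g \<in> carrier (isotropy_group d t)"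
  shows "h \<otimes>\<^bsub>isotropy_group d t\<^esub> g = compose (carrier (tensor_space d)) h g"
proof -
  have "h \<in> Bij (carrier (tensor_space d))" "g \<in> Bij (carrier (tensor_space d))"
    using assms by (auto elim!: isotropy_carrierE intro: decomposes_Bij)
  then show ?thesis
    by (simp only: isotropy_group_simps BijGroup_def monoid.simps restrict_apply')
qed

lemma isotropy_subgroup:
  assumes t: "t \<in> carrier (tensor_space d)"
  shows "subgroup (carrier (isotropy_group d t)) (BijGroup (carrier (tensor_space d)))"
proof (rule group.subgroupI[OF group_BijGroup])
  let ?C = "carrier (tensor_space d)"
  have Bij: "g \<in> Bij ?C" if "g \<in> carrier (isotropy_group d t)" for g
    using that by (auto elim!: isotropy_carrierE intro: decomposes_Bij)
  then show "carrier (isotropy_group d t) \<subseteq> carrier (BijGroup ?C)"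
    by (auto simp: BijGroup_def)
  have "(\<lambda>x \<in> ?C. x) \<in> carrier (isotropy_group d t)"
    using decomposes_id[of d] t by (auto simp: isotropy_group_simps decomposable_auts_iff)
  then show "carrier (isotropy_group d t) \<noteq> {}" by blast
next
  let ?C = "carrier (tensor_space d)"
  fix g assume g: "g \<in> carrier (isotropy_group d t)"
  then obtain \<rho> \<phi> where dg: "decomposes d \<rho> \<phi> g" and gt: "g t = t" by (rule isotropy_carrierE)
  obtain \<psi> where "decomposes d (inv_into UNIV \<rho>) \<psi> (\<lambda>x \<in> ?C. inv_into ?C g x)"
    using decomposes_inv[OF dg] .
  moreover have "inv_into ?C g t = t"
    using dg gt bij_betw_inv_into_left[of g ?C ?C t] t by (simp add: decomposes_def)
  ultimately have "(\<lambda>x \<in> ?C. inv_into ?C g x) \<in> carrier (isotropy_group d t)"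
    using t by (auto simp: isotropy_group_simps decomposable_auts_iff)
  then show "inv\<^bsub>BijGroup ?C\<^esub> g \<in> carrier (isotropy_group d t)"
    by (simp add: inv_BijGroup[OF decomposes_Bij[OF dg]])
next
  let ?C = "carrier (tensor_space d)"
  fix h g assume h: "h \<in> carrier (isotropy_group d t)" and g: "g \<in> carrier (isotropy_group d t)"
  obtain \<rho> \<phi> where dg: "decomposes d \<rho> \<phi> g" and gt: "g t = t" using g by (rule isotropy_carrierE)
  obtain \<tau> \<psi> where dh: "decomposes d \<tau> \<psi> h" and ht: "h t = t" using h by (rule isotropy_carrierE)
  have "h \<otimes>\<^bsub>BijGroup ?C\<^esub> g = compose ?C h g"
    using isotropy_mult[OF h g] by (simp add: isotropy_group_simps)
  moreover have "compose ?C h g \<in> carrier (isotropy_group d t)"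
    using decomposes_compose[OF dg dh] t gt ht
    by (auto simp: isotropy_group_simps decomposable_auts_iff compose_eq)
  ultimately show "h \<otimes>\<^bsub>BijGroup ?C\<^esub> g \<in> carrier (isotropy_group d t)" by simp
qed

lemma isotropy_group_update:
  "isotropy_group d t = BijGroup (carrier (tensor_space d)) \<lparr>carrier := carrier (isotropy_group d t)\<rparr>"
  by (simp add: isotropy_group_def)

lemma isotropy_is_group:
  assumes "t \<in> carrier (tensor_space d)"
  shows "group (isotropy_group d t)"
  using subgroup.subgroup_is_group[OF isotropy_subgroup[OF assms] group_BijGroup]
  by (simp add: isotropy_group_update[symmetric])

lemma isotropy_inv:
  assumes t: "t \<in> carrier (tensor_space d)" and g: "g \<in> carrier (isotropy_group d t)"
  shows "inv\<^bsub>isotropy_group d t\<^esub> g =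
    (\<lambda>x \<in> carrier (tensor_space d). inv_into (carrier (tensor_space d)) g x)"
proof -
  have "g \<in> Bij (carrier (tensor_space d))"
    using g by (auto elim!: isotropy_carrierE intro: decomposes_Bij)
  then show ?thesis
    using group.m_inv_consistent[OF group_BijGroup isotropy_subgroup[OF t] g]
    by (simp add: isotropy_group_update[symmetric] inv_BijGroup)
qed

lemma algorithm_Aut_subgroup:
  assumes t: "t \<in> carrier (tensor_space d)" and A: "A \<subseteq> carrier (tensor_space d)"
  shows "subgroup (algorithm_Aut d t A) (isotropy_group d t)"
proof (rule group.subgroupI[OF isotropy_is_group[OF t]])
  let ?C = "carrier (tensor_space d)" and ?G = "isotropy_group d t"
  show "algorithm_Aut d t A \<subseteq> carrier ?G" by (auto simp: algorithm_Aut_def)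
  have "\<one>\<^bsub>?G\<^esub> ` A = A"
    using A by (force simp: isotropy_group_simps)
  then have "\<one>\<^bsub>?G\<^esub> \<in> algorithm_Aut d t A"
    using monoid.one_closed[OF group.is_monoid[OF isotropy_is_group[OF t]]]
    by (simp add: algorithm_Aut_def)
  then show "algorithm_Aut d t A \<noteq> {}" by blast
  show "inv\<^bsub>?G\<^esub> g \<in> algorithm_Aut d t A" if "g \<in> algorithm_Aut d t A" for g
  proof -
    have g: "g \<in> carrier ?G" "g ` A = A" using that by (simp_all add: algorithm_Aut_def)
    then have inj: "inj_on g ?C"
      by (auto elim!: isotropy_carrierE simp: decomposes_def bij_betw_def)
    have "(\<lambda>x \<in> ?C. inv_into ?C g x) ` A = inv_into ?C g ` (g ` A)"
      using A g(2) by (auto simp: image_iff)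
    also have "\<dots> = A" using inj A by (simp add: inv_into_image_cancel)
    finally show ?thesis
      using g(1) group.inv_closed[OF isotropy_is_group[OF t] g(1)]
      by (simp add: algorithm_Aut_def isotropy_inv[OF t])
  qed
  show "h \<otimes>\<^bsub>?G\<^esub> g \<in> algorithm_Aut d t A"
    if "h \<in> algorithm_Aut d t A" "g \<in> algorithm_Aut d t A" for h g
  proof -
    have h: "h \<in> carrier ?G" "h ` A = A" and g: "g \<in> carrier ?G" "g ` A = A"
      using that by (simp_all add: algorithm_Aut_def)
    have "compose ?C h g ` A = h ` g ` A" using A by (auto simp: compose_def image_iff)
    then show ?thesis
      using h g monoid.m_closed[OF group.is_monoid[OF isotropy_is_group[OF t]] h(1) g(1)]
      by (simp add: algorithm_Aut_def isotropy_mult)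
  qed
qed

lemma algorithm_Aut_decomposesE:
  assumes "g \<in> algorithm_Aut d t A"
  obtains \<rho> \<phi> where "decomposes d \<rho> \<phi> g" "g ` A = A"
  using assms by (auto simp: algorithm_Aut_def elim: isotropy_carrierE)

lemma decomposable_tensors_subset: "decomposable_tensors d \<subseteq> carrier (tensor_space d)"
  unfolding decomposable_tensors_def by (auto intro!: tprod_carrier)

text \<open>An injective self-map of a finite set is onto, so an inclusion is enough. Linearity then
  fixes \<open>t\<close>, being the sum of the permuted set.\<close>

lemma algorithm_AutI:
  assumes g: "decomposes d \<rho> \<phi> g" and A: "is_algorithm d t A" and sub: "g ` A \<subseteq> A"
  shows "g \<in> algorithm_Aut d t A"
proof -
  have fin: "finite A" and AC: "A \<subseteq> carrier (tensor_space d)" and t: "t = \<Sum>A"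
    using A decomposable_tensors_subset[of d] by (auto simp: is_algorithm_def)
  have inj: "inj_on g A"
    using g AC by (auto simp: decomposes_def bij_betw_def intro: inj_on_subset)
  have gA: "g ` A = A" using endo_inj_surj[OF fin sub inj] .
  have "g (\<Sum>A) = (\<Sum>a \<in> A. g a)"
    using g AC by (intro tensor_linear_sum[where f = "\<lambda>a. a" and d = d]) (auto simp: decomposes_def)
  also have "\<dots> = \<Sum>(g ` A)" using inj by (simp add: sum.reindex)
  finally have "g t = t" by (simp only: gA t)
  then show ?thesis
    using g gA by (auto simp: algorithm_Aut_def isotropy_group_simps decomposable_auts_iff)
qed

text \<open>The automorphisms that keep the order of the factors are the kernel of the map to \<open>S\<^sub>3\<close>, except
  that the permutation of a decomposable automorphism need not be unique.\<close>

definition factorwise :: "(nat \<Rightarrow> shape) \<Rightarrow> tensor \<Rightarrow> tensor set \<Rightarrow> (tensor \<Rightarrow> tensor) set" where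
  "factorwise d t A = {g \<in> algorithm_Aut d t A. \<exists>\<phi>. decomposes d id \<phi> g}"

text \<open>The permutation of the inverse cancels that of \<open>g\<close>. This one computation
  serves for inverses (numerator the identity), for conjugates, and for dividing an automorphism by
  an element of Q.\<close>

lemma factorwise_quotient:
  assumes t: "t \<in> carrier (tensor_space d)" and A: "A \<subseteq> carrier (tensor_space d)"
    and g: "g \<in> algorithm_Aut d t A" "decomposes d \<rho> \<phi> g"
    and h: "h \<in> algorithm_Aut d t A" "decomposes d \<rho> \<psi> h"
  shows "g \<otimes>\<^bsub>isotropy_group d t\<^esub> inv\<^bsub>isotropy_group d t\<^esub> h \<in> factorwise d t A"
proof -
  let ?G = "isotropy_group d t" and ?K = "algorithm_Aut d t A"
  note K = algorithm_Aut_subgroup[OF t A]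
  have \<rho>: "\<rho> permutes {1, 2, 3}" using g(2) by (simp add: decomposes_def)
  have gG: "g \<in> carrier ?G" and hG: "h \<in> carrier ?G" and iG: "inv\<^bsub>?G\<^esub> h \<in> carrier ?G"
    using g(1) h(1) subgroup.mem_carrier[OF K] subgroup.m_inv_closed[OF K] by auto
  obtain \<chi> where "decomposes d (inv_into UNIV \<rho>) \<chi> (inv\<^bsub>?G\<^esub> h)"
    using decomposes_inv[OF h(2)] unfolding isotropy_inv[OF t hG] by blast
  from decomposes_compose[OF this g(2)]
  have "\<exists>\<phi>. decomposes d id \<phi> (g \<otimes>\<^bsub>?G\<^esub> inv\<^bsub>?G\<^esub> h)"
    using permutes_inv_o(2)[OF \<rho>] by (auto simp: isotropy_mult[OF gG iG])
  then show ?thesis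
    using g(1) h(1) subgroup.m_closed[OF K] subgroup.m_inv_closed[OF K]
    by (simp add: factorwise_def)
qed

lemma factorwise_normal:
  assumes t: "t \<in> carrier (tensor_space d)" and A: "A \<subseteq> carrier (tensor_space d)"
  shows "factorwise d t A \<lhd> (isotropy_group d t)\<lparr>carrier := algorithm_Aut d t A\<rparr>"
proof -
  let ?G = "isotropy_group d t" and ?K = "algorithm_Aut d t A" and ?N = "factorwise d t A"
  note K = algorithm_Aut_subgroup[OF t A]
  note G = isotropy_is_group[OF t]
  interpret G: group ?G by (rule G)
  interpret GK: group "?G\<lparr>carrier := ?K\<rparr>" by (rule subgroup.subgroup_is_group[OF K G])
  have inv: "inv\<^bsub>?G\<lparr>carrier := ?K\<rparr>\<^esub> g = inv\<^bsub>?G\<^esub> g" if "g \<in> ?K" for g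
    using group.m_inv_consistent[OF G K that] .
  have KG: "g \<in> carrier ?G" if "g \<in> ?K" for g using subgroup.mem_carrier[OF K that] .
  have id: "\<one>\<^bsub>?G\<^esub> \<in> ?K" "decomposes d id (\<lambda>_ x. x) \<one>\<^bsub>?G\<^esub>"
    using subgroup.one_closed[OF K] decomposes_id[of d] by (simp_all add: isotropy_group_simps)
  have Nmult: "h \<otimes>\<^bsub>?G\<^esub> g \<in> ?N" if hgN: "h \<in> ?N" "g \<in> ?N" for h g
  proof -
    obtain \<phi> \<psi> where hg: "h \<in> ?K" "g \<in> ?K" "decomposes d id \<phi> g" "decomposes d id \<psi> h"
      using hgN unfolding factorwise_def by blast
    from decomposes_compose[OF hg(3,4)] show ?thesis
      using subgroup.m_closed[OF K hg(1,2)] isotropy_mult[of h d t g] KG hg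
      by (auto simp: factorwise_def)
  qed
  have Ninv: "inv\<^bsub>?G\<^esub> g \<in> ?N" if gN: "g \<in> ?N" for g
  proof -
    obtain \<phi> where g: "g \<in> ?K" "decomposes d id \<phi> g" using gN by (auto simp: factorwise_def)
    then show ?thesis
      using factorwise_quotient[OF t A id g] subgroup.m_inv_closed[OF K g(1)] KG by simp
  qed
  have "subgroup ?N (?G\<lparr>carrier := ?K\<rparr>)"
  proof (rule GK.subgroupI)
    show "?N \<subseteq> carrier (?G\<lparr>carrier := ?K\<rparr>)" by (auto simp: factorwise_def)
    show "?N \<noteq> {}" using id by (auto simp: factorwise_def)
    show "inv\<^bsub>?G\<lparr>carrier := ?K\<rparr>\<^esub> g \<in> ?N" if "g \<in> ?N" for g
      using Ninv[OF that] that inv by (simp add: factorwise_def)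
    show "h \<otimes>\<^bsub>?G\<lparr>carrier := ?K\<rparr>\<^esub> g \<in> ?N" if "h \<in> ?N" "g \<in> ?N" for h g
      using Nmult[OF that] by simp
  qed
  moreover have "x \<otimes>\<^bsub>?G\<lparr>carrier := ?K\<rparr>\<^esub> h \<otimes>\<^bsub>?G\<lparr>carrier := ?K\<rparr>\<^esub> inv\<^bsub>?G\<lparr>carrier := ?K\<rparr>\<^esub> x \<in> ?N"
    if x: "x \<in> carrier (?G\<lparr>carrier := ?K\<rparr>)" and h: "h \<in> ?N" for x h
  proof -
    have xK: "x \<in> ?K" using x by simp
    obtain \<rho> \<phi> where dx: "decomposes d \<rho> \<phi> x" using xK by (rule algorithm_Aut_decomposesE)
    obtain \<psi> where hK: "h \<in> ?K" and dh: "decomposes d id \<psi> h" using h by (auto simp: factorwise_def)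
    \<comment> \<open>Multiplying \<open>x\<close> by a factorwise map leaves its permutation
      unchanged. The conjugate is therefore a quotient of two automorphisms with the same
      \<open>\<rho>\<close>.\<close>
    have "decomposes d \<rho> (\<lambda>j y. \<phi> j (\<psi> (\<rho> j) y)) (x \<otimes>\<^bsub>?G\<^esub> h)"
      using decomposes_compose[OF dh dx] isotropy_mult[OF KG[OF xK] KG[OF hK]] by simp
    from factorwise_quotient[OF t A subgroup.m_closed[OF K xK hK] this xK dx]
    show ?thesis by (simp add: inv[OF xK])
  qed
  ultimately show ?thesis by (simp add: GK.normal_inv_iff)
qed

section \<open>Permuting the factors\<close>

text \<open>In the shapes (m,n), (n,p), (p,m) each size is shared by neighbours in a fixed cyclic
  direction. Even permutations of three factors keep the direction, odd ones reverse it, and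
  transposing every matrix restores it.\<close>

definition transpose_odd :: "(nat \<Rightarrow> nat) \<Rightarrow> complex mat \<Rightarrow> complex mat" where
  "transpose_odd \<rho> x = (if evenperm \<rho> then x else transpose_mat x)"

text \<open>The common form of all elements of Q(m,n,p). Unlike the generators themselves, it is
  stable under composition and inversion, so it survives the induction over \<open>generate\<close>.
  Only values on decomposable tensors are prescribed; linearity and bijectivity come from
  elsewhere.\<close>

definition shuffling :: "(nat \<Rightarrow> shape) \<Rightarrow> (nat \<Rightarrow> nat) \<Rightarrow> (tensor \<Rightarrow> tensor) \<Rightarrow> bool" where
  "shuffling d \<rho> h \<longleftrightarrow> \<rho> permutes {1, 2, 3} \<and>
     (\<forall>j \<in> {1, 2, 3}. d j = (if evenperm \<rho> then d (\<rho> j) else prod.swap (d (\<rho> j)))) \<and>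
     (\<forall>v \<in> factors d. h (tprod3 v) = tprod3 (\<lambda>j. transpose_odd \<rho> (v (\<rho> j))))"

lemma permutes_3_permutation: "\<rho> permutes {1, 2, 3::nat} \<Longrightarrow> permutation \<rho>"
  by (rule permutes_imp_permutation[rotated]) auto

lemma transpose_odd_compose:
  assumes "\<rho> permutes {1, 2, 3::nat}" "\<tau> permutes {1, 2, 3::nat}"
  shows "transpose_odd \<tau> (transpose_odd \<rho> x) = transpose_odd (\<rho> \<circ> \<tau>) x"
  using assms by (simp add: transpose_odd_def evenperm_comp permutes_3_permutation)

lemma shuffling_factors:
  assumes h: "shuffling d \<rho> h" and v: "v \<in> factors d"
  shows "(\<lambda>j. transpose_odd \<rho> (v (\<rho> j))) \<in> factors d"
  unfolding factors_def
proof (rule CollectI, rule ballI)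
  fix j :: nat assume j: "j \<in> {1, 2, 3}"
  have \<rho>: "\<rho> permutes {1, 2, 3}" using h by (simp add: shuffling_def)
  have "d j = (if evenperm \<rho> then d (\<rho> j) else prod.swap (d (\<rho> j)))"
    using h j unfolding shuffling_def by blast
  moreover have "v (\<rho> j) \<in> carrier (mat_space (d (\<rho> j)))"
    using v permutes_3[OF \<rho> j] unfolding factors_def by blast
  ultimately show "transpose_odd \<rho> (v (\<rho> j)) \<in> carrier (mat_space (d j))"
    by (simp add: transpose_odd_def)
qed

lemma shuffling_compose:
  assumes g: "shuffling d \<rho> g" and h: "shuffling d \<tau> h"
  shows "shuffling d (\<rho> \<circ> \<tau>) (compose (carrier (tensor_space d)) h g)"
proof -
  have \<rho>: "\<rho> permutes {1, 2, 3}" and \<tau>: "\<tau> permutes {1, 2, 3}"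
    using g h by (simp_all add: shuffling_def)
  note even = evenperm_comp[OF \<rho>[THEN permutes_3_permutation] \<tau>[THEN permutes_3_permutation]]
  have "d j = (if evenperm (\<rho> \<circ> \<tau>) then d ((\<rho> \<circ> \<tau>) j) else prod.swap (d ((\<rho> \<circ> \<tau>) j)))"
    if j: "j \<in> {1, 2, 3}" for j
  proof -
    have "d j = (if evenperm \<tau> then d (\<tau> j) else prod.swap (d (\<tau> j)))"
      using h j unfolding shuffling_def by blast
    moreover have "d (\<tau> j) = (if evenperm \<rho> then d (\<rho> (\<tau> j)) else prod.swap (d (\<rho> (\<tau> j))))"
      using g permutes_3[OF \<tau> j] unfolding shuffling_def by blast
    ultimately show ?thesis by (simp add: even)
  qed
  moreover have "compose (carrier (tensor_space d)) h g (tprod3 v) =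
      tprod3 (\<lambda>j. transpose_odd (\<rho> \<circ> \<tau>) (v ((\<rho> \<circ> \<tau>) j)))" if v: "v \<in> factors d" for v
    using g h v shuffling_factors[OF g v]
    by (simp add: compose_eq tprod3_carrier shuffling_def transpose_odd_compose[OF \<rho> \<tau>])
  ultimately show ?thesis
    unfolding shuffling_def using permutes_compose[OF \<tau> \<rho>] by (intro conjI ballI)
qed

text \<open>A permutation and its inverse have the same parity, and transposing twice is the
  identity, so a shuffle along the inverse permutation undoes \<open>g\<close> factor by
  factor.\<close>

lemma shuffling_inv:
  assumes g: "shuffling d \<rho> g"
    and bij: "bij_betw g (carrier (tensor_space d)) (carrier (tensor_space d))"
  shows "shuffling d (inv_into UNIV \<rho>)
    (\<lambda>x \<in> carrier (tensor_space d). inv_into (carrier (tensor_space d)) g x)"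
proof -
  let ?C = "carrier (tensor_space d)"
  define \<tau> where "\<tau> = inv_into UNIV \<rho>"
  have \<rho>: "\<rho> permutes {1, 2, 3}" using g by (simp add: shuffling_def)
  have \<tau>: "\<tau> permutes {1, 2, 3}" unfolding \<tau>_def using \<rho> by (rule permutes_inv)
  have \<tau>\<rho>: "\<tau> (\<rho> j) = j" "\<rho> (\<tau> j) = j" for j using permutes_inverses[OF \<rho>] by (auto simp: \<tau>_def)
  have even: "evenperm \<tau> = evenperm \<rho>"
    unfolding \<tau>_def by (rule evenperm_inv[OF permutes_3_permutation[OF \<rho>]])
  have dim: "d j = (if evenperm \<tau> then d (\<tau> j) else prod.swap (d (\<tau> j)))"
    if j: "j \<in> {1, 2, 3}" for j
  proof -
    have "d (\<tau> j) = (if evenperm \<rho> then d (\<rho> (\<tau> j)) else prod.swap (d (\<rho> (\<tau> j))))"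
      using g permutes_3[OF \<tau> j] unfolding shuffling_def by blast
    then show ?thesis by (simp add: even \<tau>\<rho>)
  qed
  have "(\<lambda>x \<in> ?C. inv_into ?C g x) (tprod3 w) = tprod3 (\<lambda>j. transpose_odd \<tau> (w (\<tau> j)))"
    if w: "w \<in> factors d" for w
  proof -
    let ?v = "\<lambda>j. transpose_odd \<tau> (w (\<tau> j))"
    have v: "?v \<in> factors d"
      unfolding factors_def
    proof (rule CollectI, rule ballI)
      fix j :: nat assume j: "j \<in> {1, 2, 3}"
      have "w (\<tau> j) \<in> carrier (mat_space (d (\<tau> j)))"
        using w permutes_3[OF \<tau> j] unfolding factors_def by blast
      then show "?v j \<in> carrier (mat_space (d j))"
        using dim[OF j] by (simp add: transpose_odd_def)
    qed
    have "g (tprod3 ?v) = tprod3 (\<lambda>j. transpose_odd \<rho> (?v (\<rho> j)))"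
      using g v by (simp add: shuffling_def)
    also have "\<dots> = tprod3 w" by (cases "evenperm \<rho>") (simp_all add: \<tau>\<rho> transpose_odd_def even)
    finally show ?thesis
      using bij_betw_inv_into_left[OF bij tprod3_carrier[OF v]] tprod3_carrier[OF w] by auto
  qed
  then show ?thesis
    using \<tau> dim unfolding shuffling_def \<tau>_def[symmetric] by (intro conjI ballI)
qed

lemma shuffling_id: "shuffling d id (\<lambda>x \<in> carrier (tensor_space d). x)"
  by (simp add: shuffling_def permutes_id transpose_odd_def tprod3_carrier)

lemma linear_iso_transpose:
  "linear_iso (mat_space s) (mat_space (prod.swap s)) transpose_mat"
proof -
  have "bij_betw transpose_mat (carrier (mat_space s)) (carrier (mat_space (prod.swap s)))"
    by (rule bij_betw_byWitness[where f' = transpose_mat]) (auto simp: module_mat_simps)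
  then show ?thesis
    by (auto simp: linear_iso_def module_mat_simps transpose_add intro!: eq_matI)
qed

text \<open>Makes an element of Q comparable, in \<open>factorwise_quotient\<close>, with any
  automorphism that permutes the factors in the same way.\<close>

lemma shuffling_decomposes:
  assumes h: "shuffling d \<rho> h" and lin: "tensor_linear d h"
    and bij: "bij_betw h (carrier (tensor_space d)) (carrier (tensor_space d))"
  shows "decomposes d \<rho> (\<lambda>_. transpose_odd \<rho>) h"
proof -
  have "linear_iso (mat_space (d (\<rho> j))) (mat_space (d j)) (transpose_odd \<rho>)"
    if "j \<in> {1, 2, 3}" for j
  proof -
    have dj: "d j = (if evenperm \<rho> then d (\<rho> j) else prod.swap (d (\<rho> j)))"
      using h that unfolding shuffling_def by blast
    show ?thesis
    proof (cases "evenperm \<rho>")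
      case True
      moreover have "transpose_odd \<rho> = (\<lambda>x. x)" using True by (auto simp: transpose_odd_def)
      moreover have "bij_betw (\<lambda>x. x) S S" for S :: "complex mat set"
        using bij_betw_id by (simp add: id_def)
      ultimately show ?thesis using dj by (simp add: linear_iso_def)
    next
      case False
      moreover have "transpose_odd \<rho> = transpose_mat" using False by (auto simp: transpose_odd_def)
      ultimately show ?thesis using linear_iso_transpose[of "d (\<rho> j)"] dj by simp
    qed
  qed
  moreover have "h (tprod3 v) = tprod3 (\<lambda>j. transpose_odd \<rho> (v (\<rho> j)))" if "v \<in> factors d" for v
    using h that by (simp add: shuffling_def)
  moreover have "\<rho> permutes {1, 2, 3}" using h by (simp add: shuffling_def)
  ultimately show ?thesis unfolding decomposes_def using lin bij by (intro conjI ballI)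
qed

section \<open>Generalized permutation matrices\<close>

text \<open>The matrix sending the basis vector e_i to s_i e_{\<pi> i}. With the scalars attached to
  columns, \<open>s\<close> is the diagonal of D in the factorization PD.\<close>

definition gen_perm :: "nat \<Rightarrow> (nat \<Rightarrow> nat) \<Rightarrow> (nat \<Rightarrow> complex) \<Rightarrow> complex mat" where
  "gen_perm n \<pi> s = mat n n (\<lambda>(r, c). if r = \<pi> c then s c else 0)"

lemma gen_perm_carrier [simp]: "gen_perm n \<pi> s \<in> carrier_mat n n"
  by (simp add: gen_perm_def)

lemma gen_perm_dim: "dim_row (gen_perm n \<pi> s) = n" "dim_col (gen_perm n \<pi> s) = n"
  by (simp_all add: gen_perm_def)

lemma gen_perm_cong:
  assumes "\<And>i. i < n \<Longrightarrow> \<pi> i = \<tau> i" "\<And>i. i < n \<Longrightarrow> s i = u i"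
  shows "gen_perm n \<pi> s = gen_perm n \<tau> u"
  using assms by (intro eq_matI) (auto simp: gen_perm_def)

lemma gen_perm_one: "gen_perm n id (\<lambda>_. 1) = 1\<^sub>m n"
  by (rule eq_matI) (auto simp: gen_perm_def)

lemma mat_mult_entry:
  assumes "A \<in> carrier_mat a b" "B \<in> carrier_mat b c" "i < a" "j < c"
  shows "(A * B) $$ (i, j) = (\<Sum>k < b. A $$ (i, k) * B $$ (k, j))"
  using assms by (simp add: times_mat_def scalar_prod_def lessThan_atLeast0)

lemma gen_perm_mult:
  assumes "\<tau> permutes {..<n}"
  shows "gen_perm n \<pi> s * gen_perm n \<tau> u = gen_perm n (\<pi> \<circ> \<tau>) (\<lambda>c. s (\<tau> c) * u c)"
proof (rule eq_matI)
  fix r c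
  assume "r < dim_row (gen_perm n (\<pi> \<circ> \<tau>) (\<lambda>c. s (\<tau> c) * u c))"
    "c < dim_col (gen_perm n (\<pi> \<circ> \<tau>) (\<lambda>c. s (\<tau> c) * u c))"
  then have rc: "r < n" "c < n" by (simp_all add: gen_perm_def)
  have \<tau>c: "\<tau> c < n" using permutes_in_image[OF assms, of c] rc by simp
  have "(gen_perm n \<pi> s * gen_perm n \<tau> u) $$ (r, c) =
      (\<Sum>k<n. gen_perm n \<pi> s $$ (r, k) * gen_perm n \<tau> u $$ (k, c))"
    using rc by (intro mat_mult_entry) auto
  also have "\<dots> = (\<Sum>k<n. if k = \<tau> c then (if r = \<pi> (\<tau> c) then s (\<tau> c) else 0) * u c else 0)"
    using rc by (intro sum.cong) (auto simp: gen_perm_def)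
  also have "\<dots> = gen_perm n (\<pi> \<circ> \<tau>) (\<lambda>c. s (\<tau> c) * u c) $$ (r, c)"
    using rc \<tau>c by (simp add: gen_perm_def)
  finally show "(gen_perm n \<pi> s * gen_perm n \<tau> u) $$ (r, c) =
      gen_perm n (\<pi> \<circ> \<tau>) (\<lambda>c. s (\<tau> c) * u c) $$ (r, c)" .
qed (simp_all add: gen_perm_def)

lemma diagonal_eq_gen_perm:
  assumes "D \<in> carrier_mat n n" "diagonal_mat D"
  shows "D = gen_perm n id (\<lambda>i. D $$ (i, i))"
  using assms by (intro eq_matI) (auto simp: gen_perm_def diagonal_mat_def)

lemma diagonal_gen_perm: "diagonal_mat (gen_perm n id s)"
  by (auto simp: diagonal_mat_def gen_perm_def)

lemma invertible_diagonal_iff: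
  "invertible_mat (gen_perm n id s) \<longleftrightarrow> (\<forall>i<n. s i \<noteq> 0)"
proof
  let ?D = "gen_perm n id s"
  assume "invertible_mat ?D"
  then obtain B where "inverts_mat ?D B" "inverts_mat B ?D"
    unfolding invertible_mat_def by blast
  then have B: "?D * B = 1\<^sub>m n" "B * ?D = 1\<^sub>m (dim_row B)"
    unfolding inverts_mat_def by (simp_all add: gen_perm_dim)
  \<comment> \<open>\<open>inverts_mat\<close> leaves the size of \<open>B\<close> open: its columns
    are read off the first product, its rows off the second, whose identity matrix has size
    \<open>dim_row B\<close>.\<close>
  have "dim_col B = n" using arg_cong[OF B(1), of dim_col] by simp
  moreover have "dim_row B = n" using arg_cong[OF B(2), of dim_col] by (simp add: gen_perm_dim)
  ultimately have carr: "B \<in> carrier_mat n n" by (intro carrier_matI)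
  show "\<forall>i<n. s i \<noteq> 0"
  proof (intro allI impI)
    fix i assume i: "i < n"
    have "1 = (?D * B) $$ (i, i)" unfolding B(1) using i by simp
    also have "\<dots> = (\<Sum>k<n. ?D $$ (i, k) * B $$ (k, i))"
      using i carr by (intro mat_mult_entry) auto
    also have "\<dots> = (\<Sum>k<n. if k = i then s i * B $$ (i, i) else 0)"
      using i by (intro sum.cong) (auto simp: gen_perm_def)
    also have "\<dots> = s i * B $$ (i, i)" using i by simp
    finally have "s i * B $$ (i, i) = 1" ..
    then show "s i \<noteq> 0" by (cases "s i = 0") simp_all
  qed
next
  assume s: "\<forall>i<n. s i \<noteq> 0"
  let ?B = "gen_perm n id (\<lambda>i. 1 / s i)"
  have "gen_perm n (id \<circ> id) (\<lambda>i. s (id i) * (1 / s i)) = 1\<^sub>m n"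
    "gen_perm n (id \<circ> id) (\<lambda>i. 1 / s (id i) * s i) = 1\<^sub>m n"
    unfolding gen_perm_one[symmetric] by (rule gen_perm_cong; use s in simp)+
  then have "gen_perm n id s * ?B = 1\<^sub>m n" "?B * gen_perm n id s = 1\<^sub>m n"
    by (simp_all only: gen_perm_mult[OF permutes_id])
  then show "invertible_mat (gen_perm n id s)"
    unfolding invertible_mat_def inverts_mat_def square_mat.simps
    by (intro conjI exI[of _ ?B]) (simp_all only: gen_perm_dim)
qed

lemma gen_perm_mats_iff:
  "a \<in> gen_perm_mats n \<longleftrightarrow>
    (\<exists>\<pi> s. \<pi> permutes {..<n} \<and> (\<forall>i<n. s i \<noteq> 0) \<and> a = gen_perm n \<pi> s)"
proof -
  have P: "permutation_matrix n P \<longleftrightarrow> (\<exists>\<pi>. \<pi> permutes {..<n} \<and> P = gen_perm n \<pi> (\<lambda>_. 1))" for P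
    by (simp add: permutation_matrix_def gen_perm_def)
  have PD: "gen_perm n \<pi> (\<lambda>_. 1) * gen_perm n id s = gen_perm n \<pi> s" for \<pi> s
    by (simp add: gen_perm_mult permutes_id)
  show ?thesis
  proof
    assume "a \<in> gen_perm_mats n"
    then obtain \<pi> D where a: "\<pi> permutes {..<n}" "a = gen_perm n \<pi> (\<lambda>_. 1) * D"
        "D \<in> carrier_mat n n" "diagonal_mat D" "invertible_mat D"
      by (auto simp: gen_perm_mats_def P)
    define s where "s i = D $$ (i, i)" for i
    have D: "D = gen_perm n id s"
      using diagonal_eq_gen_perm[OF a(3,4)] by (simp add: s_def[abs_def])
    show "\<exists>\<pi> s. \<pi> permutes {..<n} \<and> (\<forall>i<n. s i \<noteq> 0) \<and> a = gen_perm n \<pi> s"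
      using a(1,2,5) unfolding D PD invertible_diagonal_iff by blast
  next
    assume "\<exists>\<pi> s. \<pi> permutes {..<n} \<and> (\<forall>i<n. s i \<noteq> 0) \<and> a = gen_perm n \<pi> s"
    then obtain \<pi> s where a: "\<pi> permutes {..<n}" "\<forall>i<n. s i \<noteq> 0" "a = gen_perm n \<pi> s" by blast
    have "permutation_matrix n (gen_perm n \<pi> (\<lambda>_. 1))" using a(1) unfolding P by blast
    moreover have "invertible_mat (gen_perm n id s)" using a(2)
      by (simp add: invertible_diagonal_iff)
    ultimately show "a \<in> gen_perm_mats n"
      unfolding gen_perm_mats_def a(3) using diagonal_gen_perm[of n s] PD[of \<pi> s, symmetric]
        gen_perm_carrier[of n id s] by blast
  qed
qed

text \<open>\<open>mat_inv\<close> is the abstract inverse in the matrix ring, so an explicit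
  two-sided inverse is exhibited and uniqueness identifies the two. Its column \<open>r\<close>
  undoes the column of the original whose nonzero entry lies in row \<open>r\<close>.\<close>

lemma gen_perm_inverse:
  assumes \<pi>: "\<pi> permutes {..<n}" and s: "\<forall>i<n. s i \<noteq> 0"
  shows "gen_perm n \<pi> s \<in> Units (ring_mat TYPE(complex) n ())"
    and "mat_inv n (gen_perm n \<pi> s) =
      gen_perm n (inv_into UNIV \<pi>) (\<lambda>r. 1 / s (inv_into UNIV \<pi> r))"
proof -
  let ?R = "ring_mat TYPE(complex) n ()" and ?a = "gen_perm n \<pi> s"
    and ?b = "gen_perm n (inv_into UNIV \<pi>) (\<lambda>r. 1 / s (inv_into UNIV \<pi> r))"
  have inv: "inv_into UNIV \<pi> permutes {..<n}" using \<pi> by (rule permutes_inv)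
  have lt: "inv_into UNIV \<pi> i < n" if "i < n" for i
    using permutes_in_image[OF inv, of i] that by simp
  have "?a * ?b = 1\<^sub>m n" "?b * ?a = 1\<^sub>m n"
    unfolding gen_perm_mult[OF inv] gen_perm_mult[OF \<pi>] gen_perm_one[symmetric]
    using s lt by (auto intro!: gen_perm_cong simp: permutes_inverses[OF \<pi>])
  then have ab: "?a \<otimes>\<^bsub>?R\<^esub> ?b = \<one>\<^bsub>?R\<^esub>" "?b \<otimes>\<^bsub>?R\<^esub> ?a = \<one>\<^bsub>?R\<^esub>"
    by (simp_all add: ring_mat_simps)
  have carr: "?a \<in> carrier ?R" "?b \<in> carrier ?R" by (simp_all add: ring_mat_simps)
  show "?a \<in> Units ?R" using ab carr unfolding Units_def by blast
  interpret semiring ?R by (rule semiring_mat)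
  show "mat_inv n ?a = ?b" using inv_unique'[OF carr ab] by simp
qed

lemma gen_perm_mult_unit:
  assumes "i < m"
  shows "gen_perm m \<pi> s * mat_unit (m, n) (i, j) = s i \<cdot>\<^sub>m mat_unit (m, n) (\<pi> i, j)"
proof (rule eq_matI)
  fix r c assume "r < dim_row (s i \<cdot>\<^sub>m mat_unit (m, n) (\<pi> i, j))"
    "c < dim_col (s i \<cdot>\<^sub>m mat_unit (m, n) (\<pi> i, j))"
  then have rc: "r < m" "c < n" by (simp_all add: mat_unit_def)
  have "(gen_perm m \<pi> s * mat_unit (m, n) (i, j)) $$ (r, c) =
      (\<Sum>k<m. gen_perm m \<pi> s $$ (r, k) * mat_unit (m, n) (i, j) $$ (k, c))"
    using rc by (intro mat_mult_entry[where c = n]) (auto simp: mat_unit_def)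
  also have "\<dots> = (\<Sum>k<m. if k = i then (if r = \<pi> i \<and> c = j then s i else 0) else 0)"
    using rc by (intro sum.cong) (auto simp: gen_perm_def mat_unit_def)
  also have "\<dots> = (s i \<cdot>\<^sub>m mat_unit (m, n) (\<pi> i, j)) $$ (r, c)"
    using rc assms by (simp add: mat_unit_def)
  finally show "(gen_perm m \<pi> s * mat_unit (m, n) (i, j)) $$ (r, c) =
      (s i \<cdot>\<^sub>m mat_unit (m, n) (\<pi> i, j)) $$ (r, c)" .
qed (simp_all add: gen_perm_def mat_unit_def)

lemma unit_mult_gen_perm_inverse:
  assumes \<pi>: "\<pi> permutes {..<n}" and s: "\<forall>i<n. s i \<noteq> 0" and j: "j < n"
  shows "mat_unit (m, n) (i, j) * mat_inv n (gen_perm n \<pi> s) =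
    (1 / s j) \<cdot>\<^sub>m mat_unit (m, n) (i, \<pi> j)" (is "?U * ?B = ?V")
proof (rule eq_matI)
  have B: "?B = gen_perm n (inv_into UNIV \<pi>) (\<lambda>r. 1 / s (inv_into UNIV \<pi> r))"
    by (rule gen_perm_inverse[OF \<pi> s])
  show "dim_row (?U * ?B) = dim_row ?V" "dim_col (?U * ?B) = dim_col ?V"
    unfolding B by (simp_all add: gen_perm_def mat_unit_def)
  fix r c assume "r < dim_row ?V" "c < dim_col ?V"
  then have rc: "r < m" "c < n" by (simp_all add: mat_unit_def)
  \<comment> \<open>Row \<open>j\<close> of the inverse has its only nonzero entry in column
    \<open>\<pi> j\<close>.\<close>
  have eq: "j = inv_into UNIV \<pi> c \<longleftrightarrow> c = \<pi> j" using permutes_inv_eq[OF \<pi>, of c j] by auto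
  have "(?U * ?B) $$ (r, c) = (\<Sum>k<n. ?U $$ (r, k) * ?B $$ (k, c))"
    using rc by (intro mat_mult_entry[where a = m]) (auto simp: mat_unit_def B)
  also have "\<dots> = (\<Sum>k<n. if k = j then (if r = i \<and> c = \<pi> j then 1 / s j else 0) else 0)"
    unfolding B using rc eq by (intro sum.cong) (auto simp: gen_perm_def mat_unit_def)
  also have "\<dots> = ?V $$ (r, c)" using rc j by (simp add: mat_unit_def)
  finally show "(?U * ?B) $$ (r, c) = ?V $$ (r, c)" .
qed

lemma gen_perm_conj_unit:
  assumes \<pi>: "\<pi> permutes {..<n}" and u: "\<forall>j<n. u j \<noteq> 0" and i: "i < m" and j: "j < n"
  shows "gen_perm m \<alpha> s * mat_unit (m, n) (i, j) * mat_inv n (gen_perm n \<pi> u) =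
    (s i / u j) \<cdot>\<^sub>m mat_unit (m, n) (\<alpha> i, \<pi> j)"
proof -
  have U: "mat_unit (m, n) I \<in> carrier_mat m n" for I by (simp add: mat_unit_def)
  have B: "mat_inv n (gen_perm n \<pi> u) \<in> carrier_mat n n"
    by (rule mat_inv_carrier[OF gen_perm_inverse(1)[OF \<pi> u]])
  show ?thesis
    by (simp add: gen_perm_mult_unit[OF i] mult_smult_assoc_mat[OF U B]
        unit_mult_gen_perm_inverse[OF \<pi> u j])
       (rule eq_matI, auto)
qed

section \<open>The maps \<open>T(a,b,c)\<close>\<close>

abbreviation GL :: "nat \<Rightarrow> complex mat set" where
  "GL n \<equiv> Units (ring_mat TYPE(complex) n ())"

lemma GL_simps:
  assumes "a \<in> GL n"
  shows "a \<in> carrier_mat n n" "mat_inv n a \<in> GL n" "mat_inv n (mat_inv n a) = a"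
    "mat_inv n a * a = 1\<^sub>m n" "a * mat_inv n a = 1\<^sub>m n"
proof -
  interpret semiring "ring_mat TYPE(complex) n ()" by (rule semiring_mat)
  show "a \<in> carrier_mat n n" using Units_closed[OF assms] by (simp add: ring_mat_simps)
  show "mat_inv n a \<in> GL n" "mat_inv n (mat_inv n a) = a" using assms by simp_all
  show "mat_inv n a * a = 1\<^sub>m n" "a * mat_inv n a = 1\<^sub>m n"
    using Units_l_inv[OF assms] Units_r_inv[OF assms] by (simp_all add: ring_mat_simps)
qed

text \<open>The double inverse stays unsimplified because it is what \<open>T_map_tprod\<close>
  produces when the map of the inverse matrices is applied after T(a,b,c).\<close>

lemma conj_cancel:
  assumes a: "a \<in> GL m" and b: "b \<in> GL n" and x: "x \<in> carrier_mat m n"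
  shows "mat_inv m a * (a * x * mat_inv n b) * mat_inv n (mat_inv n b) = x"
proof -
  note ac = GL_simps[OF a] and bc = GL_simps[OF b]
  have ia: "mat_inv m a \<in> carrier_mat m m" and ib: "mat_inv n b \<in> carrier_mat n n"
    using GL_simps(1)[OF ac(2)] GL_simps(1)[OF bc(2)] .
  have "mat_inv m a * (a * x * mat_inv n b) * b = mat_inv m a * (a * x * mat_inv n b * b)"
    using ia ac bc ib x by (intro assoc_mult_mat) auto
  also have "a * x * mat_inv n b * b = a * x * (mat_inv n b * b)"
    using ac bc ib x by (intro assoc_mult_mat) auto
  also have "\<dots> = a * x" using ac x by (simp add: bc(4))
  also have "mat_inv m a * (a * x) = mat_inv m a * a * x"
    using ac ia x by (intro assoc_mult_mat[symmetric]) auto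
  also have "\<dots> = x" using x by (simp add: ac(4))
  finally show ?thesis by (simp only: bc(3))
qed

lemma conj_cancel':
  assumes a: "a \<in> GL m" and b: "b \<in> GL n" and x: "x \<in> carrier_mat m n"
  shows "a * (mat_inv m a * x * mat_inv n (mat_inv n b)) * mat_inv n b = x"
  using conj_cancel[OF GL_simps(2)[OF a] GL_simps(2)[OF b] x]
  by (simp add: GL_simps(3)[OF a] GL_simps(3)[OF b])

lemma conj_carrier:
  assumes "a \<in> GL m" "b \<in> GL n" "x \<in> carrier_mat m n"
  shows "a * x * mat_inv n b \<in> carrier_mat m n"
  using GL_simps(1)[OF assms(1)] GL_simps(1)[OF GL_simps(2)[OF assms(2)]] assms(3) by simp

lemma linear_iso_conj:
  assumes a: "a \<in> GL m" and b: "b \<in> GL n"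
  shows "linear_iso (mat_space (m, n)) (mat_space (m, n)) (\<lambda>x. a * x * mat_inv n b)"
proof -
  have A: "a \<in> carrier_mat m m" and B: "mat_inv n b \<in> carrier_mat n n"
    using GL_simps(1)[OF a] GL_simps(1)[OF GL_simps(2)[OF b]] .
  have "bij_betw (\<lambda>x. a * x * mat_inv n b) (carrier_mat m n) (carrier_mat m n)"
    by (rule bij_betw_byWitness[where f' = "\<lambda>x. mat_inv m a * x * mat_inv n (mat_inv n b)"])
       (use conj_cancel[OF a b] conj_cancel'[OF a b] conj_carrier[OF a b]
          conj_carrier[OF GL_simps(2)[OF a] GL_simps(2)[OF b]] in auto)
  moreover have "a * (x + y) * mat_inv n b = a * x * mat_inv n b + a * y * mat_inv n b"
    if "x \<in> carrier_mat m n" "y \<in> carrier_mat m n" for x y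
    using that A B mult_add_distrib_mat[OF A that] add_mult_distrib_mat[of "a * x" m n "a * y" _ n]
    by simp
  moreover have "a * (c \<cdot>\<^sub>m x) * mat_inv n b = c \<cdot>\<^sub>m (a * x * mat_inv n b)"
    if "x \<in> carrier_mat m n" for c x
    using that A B mult_smult_distrib[OF A that, of c] mult_smult_assoc_mat[of "a * x" m n _ n c]
    by simp
  ultimately show ?thesis by (simp add: linear_iso_def module_mat_simps)
qed

lemma T_map_linear:
  assumes a: "a \<in> GL m" and b: "b \<in> GL n" and c: "c \<in> GL p"
  shows "tensor_linear (mm_shape m n p) (T_map m n p a b c)"
  unfolding T_map_def
  by (rule tensor_linear_lin_ext, rule tprod_carrier)
     (use conj_carrier[OF a b] conj_carrier[OF b c] conj_carrier[OF c a]
       in \<open>simp_all add: units_def mat_unit_def module_mat_simps\<close>)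

lemma T_map_tprod3:
  assumes "a \<in> GL m" "b \<in> GL n" "c \<in> GL p" and v: "v \<in> factors (mm_shape m n p)"
  shows "T_map m n p a b c (tprod3 v) =
    tprod (a * v 1 * mat_inv n b) (b * v 2 * mat_inv p c) (c * v 3 * mat_inv m a)"
  unfolding tprod3_def
  by (rule T_map_tprod) (use assms in \<open>simp_all add: factors_def module_mat_simps\<close>)

lemma T_map_cancel:
  assumes a: "a \<in> GL m" and b: "b \<in> GL n" and c: "c \<in> GL p" and v: "v \<in> factors (mm_shape m n p)"
  shows "T_map m n p (mat_inv m a) (mat_inv n b) (mat_inv p c) (T_map m n p a b c (tprod3 v)) = tprod3 v"
proof -
  have vc: "v 1 \<in> carrier_mat m n" "v 2 \<in> carrier_mat n p" "v 3 \<in> carrier_mat p m"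
    using v by (simp_all add: factors_def module_mat_simps)
  show ?thesis
    unfolding T_map_tprod3[OF a b c v]
    by (simp only: T_map_tprod[OF GL_simps(2)[OF a] GL_simps(2)[OF b] GL_simps(2)[OF c]
          conj_carrier[OF a b vc(1)] conj_carrier[OF b c vc(2)] conj_carrier[OF c a vc(3)]]
        conj_cancel[OF a b vc(1)] conj_cancel[OF b c vc(2)] conj_cancel[OF c a vc(3)] tprod3_def)
qed

lemma T_map_decomposes:
  assumes a: "a \<in> GL m" and b: "b \<in> GL n" and c: "c \<in> GL p"
  shows "decomposes (mm_shape m n p) id
    (triple (\<lambda>x. a * x * mat_inv n b) (\<lambda>x. b * x * mat_inv p c) (\<lambda>x. c * x * mat_inv m a))
    (T_map m n p a b c)"
proof -
  let ?d = "mm_shape m n p"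
  note inv = GL_simps(2)[OF a] GL_simps(2)[OF b] GL_simps(2)[OF c]
  have "bij_betw (T_map m n p a b c) (carrier (tensor_space ?d)) (carrier (tensor_space ?d))"
  proof (rule tensor_linear_bij[OF T_map_linear[OF a b c] T_map_linear[OF inv]])
    fix I
    show "T_map m n p a b c (T_map m n p (mat_inv m a) (mat_inv n b) (mat_inv p c)
        (tprod3 (units ?d I))) = tprod3 (units ?d I)"
      using T_map_cancel[OF inv units_factors]
        by (simp only: GL_simps(3)[OF a] GL_simps(3)[OF b] GL_simps(3)[OF c])
    show "T_map m n p (mat_inv m a) (mat_inv n b) (mat_inv p c)
        (T_map m n p a b c (tprod3 (units ?d I))) = tprod3 (units ?d I)"
      by (rule T_map_cancel[OF a b c units_factors])
  qed
  moreover have "T_map m n p a b c (tprod3 v) = tprod3 (\<lambda>j. triple (\<lambda>x. a * x * mat_inv n b)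
      (\<lambda>x. b * x * mat_inv p c) (\<lambda>x. c * x * mat_inv m a) j (v (id j)))"
    if "v \<in> factors ?d" for v
    unfolding T_map_tprod3[OF a b c that] by (simp add: tprod3_def)
  moreover have "\<forall>j \<in> {1, 2, 3}. linear_iso (mat_space (?d (id j))) (mat_space (?d j))
      (triple (\<lambda>x. a * x * mat_inv n b) (\<lambda>x. b * x * mat_inv p c) (\<lambda>x. c * x * mat_inv m a) j)"
    using linear_iso_conj[OF a b] linear_iso_conj[OF b c] linear_iso_conj[OF c a] by simp
  ultimately show ?thesis
    unfolding decomposes_def using T_map_linear[OF a b c] permutes_id by (intro conjI ballI) blast+
qed

section \<open>Automorphisms of the natural algorithm\<close>

definition mm_index :: "nat \<Rightarrow> nat \<Rightarrow> nat \<Rightarrow> nat \<Rightarrow> nat \<times> nat" where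
  "mm_index i j k = triple (i, j) (j, k) (k, i)"

lemma mm_index_simps [simp]:
  "mm_index i j k 1 = (i, j)" "mm_index i j k (Suc 0) = (i, j)"
  "mm_index i j k 2 = (j, k)" "mm_index i j k 3 = (k, i)"
  by (simp_all add: mm_index_def)

lemma mm_indices [simp]:
  "mm_index i j k \<in> indices (mm_shape m n p) \<longleftrightarrow> i < m \<and> j < n \<and> k < p"
  by (auto simp: indices_def positions_def)

lemma mm_term_units: "mm_term m n p i j k = tprod3 (units (mm_shape m n p) (mm_index i j k))"
  by (simp add: mm_term_def tprod3_def units_def)

lemma mm_algorithm_facts:
  shows mm_tensor_carrier: "mm_tensor m n p \<in> carrier (tensor_space (mm_shape m n p))"
    and natural_algorithm_subset:
      "natural_algorithm m n p \<subseteq> carrier (tensor_space (mm_shape m n p))"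
proof -
  have A: "is_algorithm (mm_shape m n p) (mm_tensor m n p) (natural_algorithm m n p)"
    by (rule natural_algorithm_is_algorithm)
  then show "natural_algorithm m n p \<subseteq> carrier (tensor_space (mm_shape m n p))"
    using decomposable_tensors_subset by (auto simp: is_algorithm_def)
  then show "mm_tensor m n p \<in> carrier (tensor_space (mm_shape m n p))"
    using A unfolding is_algorithm_def by (auto intro: tensor_space_sum)
qed

abbreviation mm_Aut :: "nat \<Rightarrow> nat \<Rightarrow> nat \<Rightarrow> (tensor \<Rightarrow> tensor) set" where
  "mm_Aut m n p \<equiv> algorithm_Aut (mm_shape m n p) (mm_tensor m n p) (natural_algorithm m n p)"

lemma T_map_Aut:
  assumes \<alpha>: "\<alpha> permutes {..<m}" "\<forall>i<m. s i \<noteq> 0" and \<beta>: "\<beta> permutes {..<n}" "\<forall>j<n. u j \<noteq> 0"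
    and \<gamma>: "\<gamma> permutes {..<p}" "\<forall>k<p. w k \<noteq> 0"
  shows "T_map m n p (gen_perm m \<alpha> s) (gen_perm n \<beta> u) (gen_perm p \<gamma> w) \<in> mm_Aut m n p"
proof (rule algorithm_AutI)
  let ?T = "T_map m n p (gen_perm m \<alpha> s) (gen_perm n \<beta> u) (gen_perm p \<gamma> w)"
    and ?d = "mm_shape m n p"
  note GL = gen_perm_inverse(1)[OF \<alpha>] gen_perm_inverse(1)[OF \<beta>] gen_perm_inverse(1)[OF \<gamma>]
  show "decomposes ?d id (triple (\<lambda>x. gen_perm m \<alpha> s * x * mat_inv n (gen_perm n \<beta> u))
      (\<lambda>x. gen_perm n \<beta> u * x * mat_inv p (gen_perm p \<gamma> w))
      (\<lambda>x. gen_perm p \<gamma> w * x * mat_inv m (gen_perm m \<alpha> s))) ?T"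
    by (rule T_map_decomposes[OF GL])
  show "is_algorithm ?d (mm_tensor m n p) (natural_algorithm m n p)"
    by (rule natural_algorithm_is_algorithm)
  have "?T (mm_term m n p i j k) \<in> natural_algorithm m n p"
    if ijk: "i < m" "j < n" "k < p" for i j k
  proof -
    have lt: "\<alpha> i < m" "\<beta> j < n" "\<gamma> k < p"
      using ijk permutes_in_image[OF \<alpha>(1), of i] permutes_in_image[OF \<beta>(1), of j]
        permutes_in_image[OF \<gamma>(1), of k] by simp_all
    \<comment> \<open>The product of these scalars telescopes around the cycle to 1, so the image is
      exactly a term of the algorithm and not a multiple of one.\<close>
    let ?c = "triple (s i / u j) (u j / w k) (w k / s i)"
    let ?x = "triple ((s i / u j) \<cdot>\<^sub>m mat_unit (m, n) (\<alpha> i, \<beta> j))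
      ((u j / w k) \<cdot>\<^sub>m mat_unit (n, p) (\<beta> j, \<gamma> k)) ((w k / s i) \<cdot>\<^sub>m mat_unit (p, m) (\<gamma> k, \<alpha> i))"
    have "?T (mm_term m n p i j k) = tprod3 ?x"
      unfolding mm_term_units T_map_tprod3[OF GL units_factors]
      by (simp add: units_def gen_perm_conj_unit[OF \<alpha>] gen_perm_conj_unit[OF \<beta>]
          gen_perm_conj_unit[OF \<gamma>] ijk)
    also have "\<dots> = tscale (?c 1 * ?c 2 * ?c 3) (tprod3 (units ?d (mm_index (\<alpha> i) (\<beta> j) (\<gamma> k))))"
      by (rule tprod3_scale) (use lt in \<open>auto simp: units_def\<close>)
    also have "?c 1 * ?c 2 * ?c 3 = 1" using \<alpha>(2) \<beta>(2) \<gamma>(2) ijk by simp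
    finally have "?T (mm_term m n p i j k) = mm_term m n p (\<alpha> i) (\<beta> j) (\<gamma> k)"
      by (simp add: mm_term_units)
    then show ?thesis using lt by (auto simp: natural_algorithm_def)
  qed
  then show "?T ` natural_algorithm m n p \<subseteq> natural_algorithm m n p"
    by (auto simp: natural_algorithm_def)
qed

section \<open>Action of an automorphism on single matrix units\<close>

lemma mm_Aut_unitE:
  assumes g: "g \<in> mm_Aut m n p" "decomposes (mm_shape m n p) \<rho> \<phi> g"
    and ijk: "i < m" "j < n" "k < p"
  obtains i' j' k' c where "i' < m" "j' < n" "k' < p" "c 1 * c 2 * c 3 = 1"
    and "\<And>l. l \<in> {1, 2, 3} \<Longrightarrow> c l \<noteq> 0 \<and> \<phi> l (units (mm_shape m n p) (mm_index i j k) (\<rho> l)) =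
      c l \<cdot>\<^sub>m units (mm_shape m n p) (mm_index i' j' k') l"
proof -
  let ?d = "mm_shape m n p"
  let ?v = "units ?d (mm_index i j k)"
  have "g (tprod3 ?v) \<in> g ` natural_algorithm m n p"
    using ijk by (auto simp: natural_algorithm_def mm_term_units)
  also have "\<dots> = natural_algorithm m n p" using g(1) by (simp add: algorithm_Aut_def)
  finally obtain i' j' k' where ijk': "i' < m" "j' < n" "k' < p"
      "g (tprod3 ?v) = tprod3 (units ?d (mm_index i' j' k'))"
    unfolding natural_algorithm_def mm_term_units by blast
  then have eq: "tprod3 (\<lambda>l. \<phi> l (?v (\<rho> l))) = tprod3 (units ?d (mm_index i' j' k'))"
    using g(2) by (simp add: decomposes_def)
  have fac: "(\<lambda>l. \<phi> l (?v (\<rho> l))) \<in> factors ?d" by (rule decomposes_factors[OF g(2) units_factors])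
  have ind: "mm_index i' j' k' \<in> indices ?d" using ijk' by simp
  show ?thesis
    by (rule tprod3_eq_unitsE[OF eq fac ind]) (rule that[OF ijk'(1-3)])
qed

lemma linear_iso_unit_inj:
  assumes f: "linear_iso (mat_space s) (mat_space s') f" and "I \<in> positions s" "J \<in> positions s"
    and IJ: "f (mat_unit s I) = a \<cdot>\<^sub>m U" "f (mat_unit s J) = b \<cdot>\<^sub>m U" and "a \<noteq> 0" "b \<noteq> 0"
  shows "I = J"
proof -
  have U: "mat_unit s K \<in> carrier (mat_space s)" "x \<cdot>\<^sub>m mat_unit s K \<in> carrier (mat_space s)" for x K
    by (simp_all add: module_mat_simps)
  have sm: "f (x \<cdot>\<^sub>m mat_unit s K) = x \<cdot>\<^sub>m f (mat_unit s K)" for x K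
    using f U(1) by (simp add: linear_iso_def module_mat_simps)
  \<comment> \<open>Cross-multiplication: both images equal the product of \<open>a\<close> and
    \<open>b\<close> times \<open>U\<close>, so injectivity of \<open>f\<close> makes the two units
    proportional.\<close>
  have "f (b \<cdot>\<^sub>m mat_unit s I) = f (a \<cdot>\<^sub>m mat_unit s J)"
    unfolding sm IJ by (rule eq_matI) auto
  then have "b \<cdot>\<^sub>m mat_unit s I = a \<cdot>\<^sub>m mat_unit s J"
    using f U unfolding linear_iso_def bij_betw_def inj_on_def by blast
  then show ?thesis using assms by (intro smult_unit_eqD)
qed

text \<open>Every matrix unit is a factor of some term: it prescribes two of the three indices, and
  the free one is set to 0, which is in range because the sizes are positive.\<close>

lemma mm_Aut_unit_image:
  assumes g: "g \<in> mm_Aut m n p" "decomposes (mm_shape m n p) \<rho> \<phi> g"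
    and pos: "m > 0" "n > 0" "p > 0"
    and l: "l \<in> {1, 2, 3}" and I: "I \<in> positions (mm_shape m n p (\<rho> l))"
  shows "\<exists>c J. c \<noteq> 0 \<and> J \<in> positions (mm_shape m n p l) \<and>
    \<phi> l (mat_unit (mm_shape m n p (\<rho> l)) I) = c \<cdot>\<^sub>m mat_unit (mm_shape m n p l) J"
proof -
  let ?d = "mm_shape m n p"
  have "\<rho> permutes {1, 2, 3}" using g(2) by (simp add: decomposes_def)
  then have "\<rho> l \<in> {1, 2, 3}" using l by (rule permutes_3)
  then consider "\<rho> l = 1" | "\<rho> l = 2" | "\<rho> l = 3" by blast
  then obtain i j k where ijk: "i < m" "j < n" "k < p" "mm_index i j k (\<rho> l) = I"
  proof cases
    case 1 show ?thesis
      by (rule that[of "fst I" "snd I" 0]) (use 1 I pos in \<open>auto simp: positions_def\<close>)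
  next
    case 2 show ?thesis
      by (rule that[of 0 "fst I" "snd I"]) (use 2 I pos in \<open>auto simp: positions_def\<close>)
  next
    case 3 show ?thesis
      by (rule that[of "snd I" 0 "fst I"]) (use 3 I pos in \<open>auto simp: positions_def\<close>)
  qed
  obtain i' j' k' c where *: "i' < m" "j' < n" "k' < p"
      "c l \<noteq> 0 \<and> \<phi> l (units ?d (mm_index i j k) (\<rho> l)) = c l \<cdot>\<^sub>m units ?d (mm_index i' j' k') l"
    by (rule mm_Aut_unitE[OF g ijk(1-3)]) (use l in blast)
  moreover have "mm_index i' j' k' l \<in> positions (?d l)"
    using *(1-3) l mm_indices[of i' j' k' m n p] unfolding indices_def by blast
  ultimately show ?thesis using ijk(4) unfolding units_def by blast
qed

lemma mm_Aut_unit_maps: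
  assumes g: "g \<in> mm_Aut m n p" "decomposes (mm_shape m n p) \<rho> \<phi> g"
    and pos: "m > 0" "n > 0" "p > 0" and l: "l \<in> {1, 2, 3}"
  obtains c J where "inj_on J (positions (mm_shape m n p (\<rho> l)))"
    and "\<And>I. I \<in> positions (mm_shape m n p (\<rho> l)) \<Longrightarrow>
      c I \<noteq> 0 \<and> J I \<in> positions (mm_shape m n p l) \<and>
      \<phi> l (mat_unit (mm_shape m n p (\<rho> l)) I) = c I \<cdot>\<^sub>m mat_unit (mm_shape m n p l) (J I)"
proof -
  let ?d = "mm_shape m n p"
  obtain c J where cJ: "\<And>I. I \<in> positions (?d (\<rho> l)) \<Longrightarrow> c I \<noteq> 0 \<and> J I \<in> positions (?d l) \<and>
      \<phi> l (mat_unit (?d (\<rho> l)) I) = c I \<cdot>\<^sub>m mat_unit (?d l) (J I)"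
    using mm_Aut_unit_image[OF g pos l] by metis
  have iso: "linear_iso (mat_space (?d (\<rho> l))) (mat_space (?d l)) (\<phi> l)"
    using g(2) l unfolding decomposes_def by blast
  have "inj_on J (positions (?d (\<rho> l)))"
  proof (rule inj_onI)
    fix I I' assume I: "I \<in> positions (?d (\<rho> l))" "I' \<in> positions (?d (\<rho> l))" and eq: "J I = J I'"
    show "I = I'"
      using linear_iso_unit_inj[OF iso I, of "c I" "mat_unit (?d l) (J I)" "c I'"]
        cJ[OF I(1)] cJ[OF I(2)]
      by (simp add: eq)
  qed
  then show ?thesis using cJ by (rule that)
qed

text \<open>Injectivity on units gives only an inequality, but along each cycle of
  \<open>\<rho>\<close> the inequalities close up and become equalities of dimensions.\<close>

lemma mm_Aut_card_le:
  assumes g: "g \<in> mm_Aut m n p" "decomposes (mm_shape m n p) \<rho> \<phi> g"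
    and pos: "m > 0" "n > 0" "p > 0" and l: "l \<in> {1, 2, 3}"
  shows "card (positions (mm_shape m n p (\<rho> l))) \<le> card (positions (mm_shape m n p l))"
proof (rule mm_Aut_unit_maps[OF g pos l])
  fix c J assume "inj_on J (positions (mm_shape m n p (\<rho> l)))"
    and cJ: "\<And>I. I \<in> positions (mm_shape m n p (\<rho> l)) \<Longrightarrow>
      c I \<noteq> 0 \<and> J I \<in> positions (mm_shape m n p l) \<and>
      \<phi> l (mat_unit (mm_shape m n p (\<rho> l)) I) = c I \<cdot>\<^sub>m mat_unit (mm_shape m n p l) (J I)"
  then show ?thesis by (intro card_inj_on_le[of J]) auto
qed

section \<open>Monomial maps whose indices match cyclically\<close>

lemma inj_extend_permutes:
  fixes h :: "nat \<Rightarrow> nat"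
  assumes "inj_on h {..<n}" "h ` {..<n} \<subseteq> {..<n}"
  shows "(\<lambda>i. if i < n then h i else i) permutes {..<n}"
proof (rule bij_imp_permutes)
  have "h ` {..<n} = {..<n}" by (rule endo_inj_surj[OF _ assms(2,1)]) simp
  then have "bij_betw h {..<n} {..<n}" using assms(1) by (simp add: bij_betw_def)
  then show "bij_betw (\<lambda>i. if i < n then h i else i) {..<n} {..<n}"
    by (rule bij_betw_cong[THEN iffD1, rotated]) simp
qed simp

text \<open>Since consecutive factors of each term share an index, the image of \<open>e\<^sub>i\<^sub>j\<close> can only depend on
  \<open>i\<close> and \<open>j\<close> through separate permutations, and the scalars form a coboundary.\<close>

lemma cyclic_monomial_maps:
  fixes f1 f2 f3 :: "nat \<times> nat \<Rightarrow> nat \<times> nat" and l1 l2 l3 :: "nat \<times> nat \<Rightarrow> complex"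
  assumes pos: "m > 0" "n > 0" "p > 0"
    and ran: "\<And>i j. i < m \<Longrightarrow> j < n \<Longrightarrow> f1 (i, j) \<in> {..<m} \<times> {..<n}"
      "\<And>j k. j < n \<Longrightarrow> k < p \<Longrightarrow> f2 (j, k) \<in> {..<n} \<times> {..<p}"
      "\<And>k i. k < p \<Longrightarrow> i < m \<Longrightarrow> f3 (k, i) \<in> {..<p} \<times> {..<m}"
    and inj: "inj_on f1 ({..<m} \<times> {..<n})" "inj_on f2 ({..<n} \<times> {..<p})" "inj_on f3 ({..<p} \<times> {..<m})"
    and chain: "\<And>i j k. i < m \<Longrightarrow> j < n \<Longrightarrow> k < p \<Longrightarrow> snd (f1 (i, j)) = fst (f2 (j, k)) \<and>
      snd (f2 (j, k)) = fst (f3 (k, i)) \<and> snd (f3 (k, i)) = fst (f1 (i, j))"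
    and scal: "\<And>i j k. i < m \<Longrightarrow> j < n \<Longrightarrow> k < p \<Longrightarrow> l1 (i, j) * l2 (j, k) * l3 (k, i) = 1"
  obtains \<alpha> \<beta> \<gamma> s u w where "\<alpha> permutes {..<m}" "\<beta> permutes {..<n}" "\<gamma> permutes {..<p}"
    and "\<forall>i<m. s i \<noteq> 0" "\<forall>j<n. u j \<noteq> 0" "\<forall>k<p. w k \<noteq> 0"
    and "\<forall>i<m. \<forall>j<n. f1 (i, j) = (\<alpha> i, \<beta> j) \<and> l1 (i, j) = s i / u j"
    and "\<forall>j<n. \<forall>k<p. f2 (j, k) = (\<beta> j, \<gamma> k) \<and> l2 (j, k) = u j / w k"
    and "\<forall>k<p. \<forall>i<m. f3 (k, i) = (\<gamma> k, \<alpha> i) \<and> l3 (k, i) = w k / s i"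
proof -
  \<comment> \<open>The index 0 is an arbitrary representative: \<open>chain\<close> equates the
    first coordinate of \<open>f1 (i, j)\<close> with a coordinate of \<open>f3 (k, i)\<close>,
    which does not involve \<open>j\<close>. Beyond the range the identity is used, as
    \<open>permutes\<close> requires.\<close>
  define \<alpha> where "\<alpha> i = (if i < m then fst (f1 (i, 0)) else i)" for i
  define \<beta> where "\<beta> j = (if j < n then fst (f2 (j, 0)) else j)" for j
  define \<gamma> where "\<gamma> k = (if k < p then fst (f3 (k, 0)) else k)" for k
  \<comment> \<open>The equations to be solved determine the scalars once \<open>w 0 = 1\<close> is
    imposed: l3(0,i) = 1/s_i, l2(j,0) = u_j, and l3(k,0) = w_k/s_0.\<close>
  define s where "s i = 1 / l3 (0, i)" for i
  define u where "u j = l2 (j, 0)" for j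
  define w where "w k = l3 (k, 0) / l3 (0, 0)" for k
  have f1: "f1 (i, j) = (\<alpha> i, \<beta> j)" if "i < m" "j < n" for i j
    using chain[of i j 0] chain[of i 0 0] that pos by (simp add: \<alpha>_def \<beta>_def prod_eq_iff)
  have f2: "f2 (j, k) = (\<beta> j, \<gamma> k)" if "j < n" "k < p" for j k
    using chain[of 0 j k] chain[of 0 j 0] that pos by (simp add: \<beta>_def \<gamma>_def prod_eq_iff)
  have f3: "f3 (k, i) = (\<gamma> k, \<alpha> i)" if "k < p" "i < m" for k i
    using chain[of i 0 k] chain[of 0 0 k] that pos by (simp add: \<alpha>_def \<gamma>_def prod_eq_iff)
  have nz: "l1 (i, j) \<noteq> 0" "l2 (j, k) \<noteq> 0" "l3 (k, i) \<noteq> 0" if "i < m" "j < n" "k < p" for i j k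
    using scal[OF that] by auto
  have s0: "s i \<noteq> 0" if "i < m" for i using nz[OF that pos(2,3)] by (simp add: s_def)
  have u0: "u j \<noteq> 0" if "j < n" for j using nz[OF pos(1) that pos(3)] by (simp add: u_def)
  have w0: "w k \<noteq> 0" if "k < p" for k using nz[OF pos(1,2) that] nz[OF pos] by (simp add: w_def)
  have l1: "l1 (i, j) = s i / u j" if "i < m" "j < n" for i j
    using scal[OF that pos(3)] nz[OF that pos(3)] by (simp add: s_def u_def field_simps)
  have l2: "l2 (j, k) = u j / w k" if "j < n" "k < p" for j k
  proof -
    \<comment> \<open>Both sides are 1, by the triples (0,j,k) and (0,j,0). Cancelling
      \<open>l1 (0, j)\<close> leaves a relation between \<open>l2\<close> and \<open>l3\<close>
      alone.\<close>
    have "l1 (0, j) * (l2 (j, k) * l3 (k, 0)) = l1 (0, j) * (l2 (j, 0) * l3 (0, 0))"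
      using scal[OF pos(1) that] scal[OF pos(1) that(1) pos(3)] by (simp add: mult.assoc)
    then have "l2 (j, k) * l3 (k, 0) = l2 (j, 0) * l3 (0, 0)"
      using nz(1)[OF pos(1) that] by simp
    then show ?thesis using nz(3)[OF pos(1) that] nz(3)[OF pos]
      by (simp add: u_def w_def field_simps)
  qed
  have l3: "l3 (k, i) = w k / s i" if "k < p" "i < m" for k i
    using scal[OF that(2) pos(2) that(1)] l1[OF that(2) pos(2)] l2[OF pos(2) that(1)]
      s0[OF that(2)] u0[OF pos(2)] w0[OF that(1)] by (simp add: field_simps)
  have "inj_on (\<lambda>i. fst (f1 (i, 0))) {..<m}"
  proof (rule inj_onI)
    fix i i' assume "i \<in> {..<m}" "i' \<in> {..<m}" "fst (f1 (i, 0)) = fst (f1 (i', 0))"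
    \<comment> \<open>The second coordinates are both \<open>\<beta> 0\<close>, so equal first
      coordinates already give equal pairs. The same argument is used for \<open>\<beta>\<close> and
      \<open>\<gamma>\<close>.\<close>
    then have "f1 (i, 0) = f1 (i', 0)" "(i, 0) \<in> {..<m} \<times> {..<n}" "(i', 0) \<in> {..<m} \<times> {..<n}"
      using f1[of i 0] f1[of i' 0] pos by simp_all
    then show "i = i'" using inj_onD[OF inj(1)] by blast
  qed
  moreover have "(\<lambda>i. fst (f1 (i, 0))) ` {..<m} \<subseteq> {..<m}"
    using ran(1)[of _ 0] pos by (auto simp: mem_Times_iff)
  ultimately have \<alpha>: "\<alpha> permutes {..<m}" using inj_extend_permutes by (simp add: \<alpha>_def[abs_def])
  have "inj_on (\<lambda>j. fst (f2 (j, 0))) {..<n}"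
  proof (rule inj_onI)
    fix j j' assume "j \<in> {..<n}" "j' \<in> {..<n}" "fst (f2 (j, 0)) = fst (f2 (j', 0))"
    then have "f2 (j, 0) = f2 (j', 0)" "(j, 0) \<in> {..<n} \<times> {..<p}" "(j', 0) \<in> {..<n} \<times> {..<p}"
      using f2[of j 0] f2[of j' 0] pos by simp_all
    then show "j = j'" using inj_onD[OF inj(2)] by blast
  qed
  moreover have "(\<lambda>j. fst (f2 (j, 0))) ` {..<n} \<subseteq> {..<n}"
    using ran(2)[of _ 0] pos by (auto simp: mem_Times_iff)
  ultimately have \<beta>: "\<beta> permutes {..<n}" using inj_extend_permutes by (simp add: \<beta>_def[abs_def])
  have "inj_on (\<lambda>k. fst (f3 (k, 0))) {..<p}"
  proof (rule inj_onI)
    fix k k' assume "k \<in> {..<p}" "k' \<in> {..<p}" "fst (f3 (k, 0)) = fst (f3 (k', 0))"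
    then have "f3 (k, 0) = f3 (k', 0)" "(k, 0) \<in> {..<p} \<times> {..<m}" "(k', 0) \<in> {..<p} \<times> {..<m}"
      using f3[of k 0] f3[of k' 0] pos by simp_all
    then show "k = k'" using inj_onD[OF inj(3)] by blast
  qed
  moreover have "(\<lambda>k. fst (f3 (k, 0))) ` {..<p} \<subseteq> {..<p}"
    using ran(3)[of _ 0] pos by (auto simp: mem_Times_iff)
  ultimately have \<gamma>: "\<gamma> permutes {..<p}" using inj_extend_permutes by (simp add: \<gamma>_def[abs_def])
  show ?thesis
    by (rule that[OF \<alpha> \<beta> \<gamma>, of s u w]) (use s0 u0 w0 f1 f2 f3 l1 l2 l3 in simp_all)
qed

lemma smult_unit_eq_coeff:
  assumes "a \<cdot>\<^sub>m mat_unit s I = b \<cdot>\<^sub>m mat_unit s I" "I \<in> positions s"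
  shows "a = b"
proof -
  have "(a \<cdot>\<^sub>m mat_unit s I) $$ I = (b \<cdot>\<^sub>m mat_unit s I) $$ I" by (simp add: assms)
  then show ?thesis using assms(2) by (cases I) (simp add: mat_unit_def positions_def)
qed

lemma factorwise_subset_gen_perm:
  assumes pos: "m > 0" "n > 0" "p > 0"
    and gN: "g \<in> factorwise (mm_shape m n p) (mm_tensor m n p) (natural_algorithm m n p)"
  shows "g \<in> gen_perm_subgroup m n p"
proof -
  let ?d = "mm_shape m n p"
  obtain \<phi> where g: "g \<in> mm_Aut m n p" "decomposes ?d id \<phi> g"
    using gN unfolding factorwise_def by blast
  obtain l1 f1 where inj1: "inj_on f1 (positions (?d 1))" and f1: "\<And>I. I \<in> positions (?d 1) \<Longrightarrow>
      l1 I \<noteq> 0 \<and> f1 I \<in> positions (?d 1) \<and> \<phi> 1 (mat_unit (?d 1) I) = l1 I \<cdot>\<^sub>m mat_unit (?d 1) (f1 I)"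
    by (rule mm_Aut_unit_maps[OF g pos, of 1, unfolded id_apply]) auto
  obtain l2 f2 where inj2: "inj_on f2 (positions (?d 2))" and f2: "\<And>I. I \<in> positions (?d 2) \<Longrightarrow>
      l2 I \<noteq> 0 \<and> f2 I \<in> positions (?d 2) \<and> \<phi> 2 (mat_unit (?d 2) I) = l2 I \<cdot>\<^sub>m mat_unit (?d 2) (f2 I)"
    by (rule mm_Aut_unit_maps[OF g pos, of 2, unfolded id_apply]) auto
  obtain l3 f3 where inj3: "inj_on f3 (positions (?d 3))" and f3: "\<And>I. I \<in> positions (?d 3) \<Longrightarrow>
      l3 I \<noteq> 0 \<and> f3 I \<in> positions (?d 3) \<and> \<phi> 3 (mat_unit (?d 3) I) = l3 I \<cdot>\<^sub>m mat_unit (?d 3) (f3 I)"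
    by (rule mm_Aut_unit_maps[OF g pos, of 3, unfolded id_apply]) auto
  have P: "positions (?d 1) = {..<m} \<times> {..<n}" "positions (?d 2) = {..<n} \<times> {..<p}"
    "positions (?d 3) = {..<p} \<times> {..<m}" by (simp_all add: positions_def)
  have F1: "l1 (i, j) \<noteq> 0" "f1 (i, j) \<in> {..<m} \<times> {..<n}"
      "\<phi> 1 (mat_unit (m, n) (i, j)) = l1 (i, j) \<cdot>\<^sub>m mat_unit (m, n) (f1 (i, j))"
    if "i < m" "j < n" for i j
    using f1[of "(i, j)"] that by (simp_all add: P(1)[simplified])
  have F2: "l2 (j, k) \<noteq> 0" "f2 (j, k) \<in> {..<n} \<times> {..<p}"
      "\<phi> 2 (mat_unit (n, p) (j, k)) = l2 (j, k) \<cdot>\<^sub>m mat_unit (n, p) (f2 (j, k))"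
    if "j < n" "k < p" for j k
    using f2[of "(j, k)"] that by (simp_all add: P(2)[simplified])
  have F3: "l3 (k, i) \<noteq> 0" "f3 (k, i) \<in> {..<p} \<times> {..<m}"
      "\<phi> 3 (mat_unit (p, m) (k, i)) = l3 (k, i) \<cdot>\<^sub>m mat_unit (p, m) (f3 (k, i))"
    if "k < p" "i < m" for k i
    using f3[of "(k, i)"] that by (simp_all add: P(3)[simplified])
  \<comment> \<open>The index maps \<open>f1\<close>, \<open>f2\<close>, \<open>f3\<close> were
    chosen independently of each other. That their values match, and that the scalars have product
    1, is visible only on a whole term, whose image is again a term.\<close>
  have key: "\<exists>i' j' k'. f1 (i, j) = (i', j') \<and> f2 (j, k) = (j', k') \<and> f3 (k, i) = (k', i') \<and>
      l1 (i, j) * l2 (j, k) * l3 (k, i) = 1" if ijk: "i < m" "j < n" "k < p" for i j k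
  proof -
    obtain i' j' k' c where r: "i' < m" "j' < n" "k' < p" and c: "c 1 * c 2 * c 3 = 1"
      and \<phi>: "\<And>l. l \<in> {1, 2, 3} \<Longrightarrow> c l \<noteq> 0 \<and> \<phi> l (units ?d (mm_index i j k) (id l)) =
        c l \<cdot>\<^sub>m units ?d (mm_index i' j' k') l"
      using mm_Aut_unitE[OF g ijk] by blast
    have e: "l1 (i, j) \<cdot>\<^sub>m mat_unit (m, n) (f1 (i, j)) = c 1 \<cdot>\<^sub>m mat_unit (m, n) (i', j')"
      "l2 (j, k) \<cdot>\<^sub>m mat_unit (n, p) (f2 (j, k)) = c 2 \<cdot>\<^sub>m mat_unit (n, p) (j', k')"
      "l3 (k, i) \<cdot>\<^sub>m mat_unit (p, m) (f3 (k, i)) = c 3 \<cdot>\<^sub>m mat_unit (p, m) (k', i')"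
      using \<phi>[of 1] \<phi>[of 2] \<phi>[of 3] F1(3)[OF ijk(1,2)] F2(3)[OF ijk(2,3)] F3(3)[OF ijk(3,1)]
      by (simp_all add: units_def)
    have f: "f1 (i, j) = (i', j')" "f2 (j, k) = (j', k')" "f3 (k, i) = (k', i')"
      using smult_unit_eqD[OF e(1)] smult_unit_eqD[OF e(2)] smult_unit_eqD[OF e(3)]
        F1[OF ijk(1,2)] F2[OF ijk(2,3)] F3[OF ijk(3,1)] r
      by (simp_all add: positions_def)
    have "l1 (i, j) = c 1" "l2 (j, k) = c 2" "l3 (k, i) = c 3"
      using smult_unit_eq_coeff[OF e(1)[unfolded f]] smult_unit_eq_coeff[OF e(2)[unfolded f]]
        smult_unit_eq_coeff[OF e(3)[unfolded f]] r
      by (simp_all add: positions_def)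
    then show ?thesis using f c by simp
  qed
  have chain: "snd (f1 (i, j)) = fst (f2 (j, k)) \<and> snd (f2 (j, k)) = fst (f3 (k, i)) \<and>
      snd (f3 (k, i)) = fst (f1 (i, j))" and scal: "l1 (i, j) * l2 (j, k) * l3 (k, i) = 1"
    if "i < m" "j < n" "k < p" for i j k
    using key[OF that] by auto
  obtain \<alpha> \<beta> \<gamma> s u w where
    \<alpha>: "\<alpha> permutes {..<m}" and \<beta>: "\<beta> permutes {..<n}" and \<gamma>: "\<gamma> permutes {..<p}"
    and s: "\<forall>i<m. s i \<noteq> 0" and u: "\<forall>j<n. u j \<noteq> 0" and w: "\<forall>k<p. w k \<noteq> 0"
    and G1: "\<forall>i<m. \<forall>j<n. f1 (i, j) = (\<alpha> i, \<beta> j) \<and> l1 (i, j) = s i / u j"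
    and G2: "\<forall>j<n. \<forall>k<p. f2 (j, k) = (\<beta> j, \<gamma> k) \<and> l2 (j, k) = u j / w k"
    and G3: "\<forall>k<p. \<forall>i<m. f3 (k, i) = (\<gamma> k, \<alpha> i) \<and> l3 (k, i) = w k / s i"
    by (rule cyclic_monomial_maps[where ?f1.0 = f1 and ?f2.0 = f2 and ?f3.0 = f3 and ?l1.0 = l1
          and ?l2.0 = l2 and ?l3.0 = l3, OF pos F1(2) F2(2) F3(2) inj1[unfolded P] inj2[unfolded P]
          inj3[unfolded P] chain scal]; (rule that; assumption | assumption))
  note GLs = gen_perm_inverse(1)[OF \<alpha> s] gen_perm_inverse(1)[OF \<beta> u] gen_perm_inverse(1)[OF \<gamma> w]
  let ?T = "T_map m n p (gen_perm m \<alpha> s) (gen_perm n \<beta> u) (gen_perm p \<gamma> w)"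
  have "g = ?T"
  proof (rule tensor_linear_eqI)
    show "tensor_linear ?d g" using g(2) by (simp add: decomposes_def)
    show "tensor_linear ?d ?T" by (rule T_map_linear[OF GLs])
    \<comment> \<open>The three pairs are unrelated, so this product of units need not be a term of
      the algorithm. The formulas for the factors still apply, because they were obtained for each
      factor separately.\<close>
    fix I assume I: "I \<in> indices ?d"
    obtain i j where I1: "I 1 = (i, j)" by fastforce
    obtain j' k where I2: "I 2 = (j', k)" by fastforce
    obtain k' i' where I3: "I 3 = (k', i')" by fastforce
    have r: "i < m" "j < n" "j' < n" "k < p" "k' < p" "i' < m"
      using I I1 I2 I3 by (simp_all add: indices_def positions_def)
    have "g (tprod3 (units ?d I)) = tprod3 (\<lambda>l. \<phi> l (units ?d I l))"
      using g(2) by (simp add: decomposes_def)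
    also have "\<dots> = tprod (\<phi> 1 (mat_unit (m, n) (i, j))) (\<phi> 2 (mat_unit (n, p) (j', k)))
        (\<phi> 3 (mat_unit (p, m) (k', i')))"
      using I1 I2 I3 by (simp add: tprod3_def units_def)
    also have "\<dots> = ?T (tprod3 (units ?d I))"
      unfolding T_map_tprod3[OF GLs units_factors] F1(3)[OF r(1,2)] F2(3)[OF r(3,4)] F3(3)[OF r(5,6)]
      using G1[rule_format, OF r(1,2)] G2[rule_format, OF r(3,4)] G3[rule_format, OF r(5,6)] I1 I2 I3
      by (simp add: units_def gen_perm_conj_unit[OF \<beta> u r(1,2)] gen_perm_conj_unit[OF \<gamma> w r(3,4)]
          gen_perm_conj_unit[OF \<alpha> s r(5,6)])
    finally show "g (tprod3 (units ?d I)) = ?T (tprod3 (units ?d I))" .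
  qed
  moreover have "gen_perm m \<alpha> s \<in> gen_perm_mats m" "gen_perm n \<beta> u \<in> gen_perm_mats n"
    "gen_perm p \<gamma> w \<in> gen_perm_mats p"
    unfolding gen_perm_mats_iff using \<alpha> \<beta> \<gamma> s u w by blast+
  ultimately show ?thesis unfolding gen_perm_subgroup_def by blast
qed

lemma gen_perm_subgroup_eq_factorwise:
  assumes "m > 0" "n > 0" "p > 0"
  shows "gen_perm_subgroup m n p =
    factorwise (mm_shape m n p) (mm_tensor m n p) (natural_algorithm m n p)"
proof
  show "gen_perm_subgroup m n p \<subseteq>
      factorwise (mm_shape m n p) (mm_tensor m n p) (natural_algorithm m n p)"
  proof
    fix g assume "g \<in> gen_perm_subgroup m n p"
    then obtain \<alpha> s \<beta> u \<gamma> w where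
      \<alpha>: "\<alpha> permutes {..<m}" "\<forall>i<m. s i \<noteq> 0" and \<beta>: "\<beta> permutes {..<n}" "\<forall>j<n. u j \<noteq> 0"
      and \<gamma>: "\<gamma> permutes {..<p}" "\<forall>k<p. w k \<noteq> 0"
      and gT: "g = T_map m n p (gen_perm m \<alpha> s) (gen_perm n \<beta> u) (gen_perm p \<gamma> w)"
      unfolding gen_perm_subgroup_def gen_perm_mats_iff by blast
    show "g \<in> factorwise (mm_shape m n p) (mm_tensor m n p) (natural_algorithm m n p)"
      unfolding factorwise_def gT using T_map_Aut[OF \<alpha> \<beta> \<gamma>]
        T_map_decomposes[OF gen_perm_inverse(1)[OF \<alpha>] gen_perm_inverse(1)[OF \<beta>]
          gen_perm_inverse(1)[OF \<gamma>]]
      by blast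
  qed
qed (use factorwise_subset_gen_perm[OF assms] in blast)

section \<open>The group \<open>Q(m,n,p)\<close>\<close>

abbreviation swap :: "nat \<Rightarrow> nat \<Rightarrow> nat \<Rightarrow> nat" where
  "swap \<equiv> Transposition.transpose"

text \<open>In x \<otimes> y \<otimes> z \<mapsto> z \<otimes> x \<otimes> y, position 1 is filled
  from 3, position 2 from 1 and position 3 from 2. Writing this as two transpositions makes its
  parity evident.\<close>

abbreviation cycle :: "nat \<Rightarrow> nat" where
  "cycle \<equiv> swap 1 2 \<circ> swap 1 3"

lemma swap_permutes_3:
  "a \<in> {1, 2, 3} \<Longrightarrow> b \<in> {1, 2, 3} \<Longrightarrow> swap a b permutes {1, 2, 3}"
  by (rule permutes_swap_id)

lemma cycle_permutes: "cycle permutes {1, 2, 3}"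
  by (intro permutes_compose swap_permutes_3) simp_all

lemma cycle_even: "evenperm cycle"
  by (simp add: evenperm_comp permutation_swap_id evenperm_swap)

lemma cycle_values: "cycle 1 = 3" "cycle 2 = 1" "cycle 3 = 2"
  by (simp_all add: transpose_def)

lemma permutes_3_eqI:
  fixes \<rho> \<tau> :: "nat \<Rightarrow> nat"
  assumes "\<rho> permutes {1, 2, 3}" "\<tau> permutes {1, 2, 3}" "\<rho> 1 = \<tau> 1" "\<rho> 2 = \<tau> 2" "\<rho> 3 = \<tau> 3"
  shows "\<rho> = \<tau>"
proof
  fix i
  show "\<rho> i = \<tau> i"
  proof (cases "i \<in> {1, 2, 3}")
    case False
    then show ?thesis using permutes_not_in[OF assms(1)] permutes_not_in[OF assms(2)] by simp
  qed (use assms(3-5) in blast)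
qed

text \<open>The six permutations are expressed by the generators of Q: the three transpositions for
  the cases of two equal sizes, the cycle and its square for equal sizes throughout.\<close>

lemma permutes_3_cases:
  assumes \<rho>: "\<rho> permutes {1, 2, 3::nat}"
  obtains "\<rho> = id" | "\<rho> = swap 1 2" | "\<rho> = swap 1 3" | "\<rho> = swap 2 3" | "\<rho> = cycle"
    | "\<rho> = cycle \<circ> cycle"
proof -
  have inj: "\<rho> i = \<rho> j \<Longrightarrow> i = j" for i j using permutes_inj[OF \<rho>] by (simp add: inj_eq)
  have ran: "\<rho> 1 \<in> {1, 2, 3}" "\<rho> 2 \<in> {1, 2, 3}" "\<rho> 3 \<in> {1, 2, 3}"
    using permutes_3[OF \<rho>] by blast+
  have ne: "\<rho> 1 \<noteq> \<rho> 2" "\<rho> 1 \<noteq> \<rho> 3" "\<rho> 2 \<noteq> \<rho> 3"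
    using inj[of 1 2] inj[of 1 3] inj[of 2 3] by auto
  note perms = cycle_permutes permutes_compose[OF cycle_permutes cycle_permutes]
  consider "\<rho> 1 = 1" "\<rho> 2 = 2" "\<rho> 3 = 3" | "\<rho> 1 = 2" "\<rho> 2 = 1" "\<rho> 3 = 3"
    | "\<rho> 1 = 3" "\<rho> 2 = 2" "\<rho> 3 = 1" | "\<rho> 1 = 1" "\<rho> 2 = 3" "\<rho> 3 = 2"
    | "\<rho> 1 = 3" "\<rho> 2 = 1" "\<rho> 3 = 2" | "\<rho> 1 = 2" "\<rho> 2 = 3" "\<rho> 3 = 1"
    using ran ne by (elim insertE emptyE) simp_all
  then show ?thesis
  proof cases
    case 1 show ?thesis
      by (rule that(1), rule permutes_3_eqI[OF \<rho> permutes_id]) (use 1 in simp_all)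
  next
    case 2 show ?thesis
      by (rule that(2), rule permutes_3_eqI[OF \<rho> swap_permutes_3])
        (use 2 in \<open>simp_all add: transpose_def\<close>)
  next
    case 3 show ?thesis
      by (rule that(3), rule permutes_3_eqI[OF \<rho> swap_permutes_3])
        (use 3 in \<open>simp_all add: transpose_def\<close>)
  next
    case 4 show ?thesis
      by (rule that(4), rule permutes_3_eqI[OF \<rho> swap_permutes_3])
        (use 4 in \<open>simp_all add: transpose_def\<close>)
  next
    case 5 show ?thesis
      by (rule that(5), rule permutes_3_eqI[OF \<rho> perms(1)]) (use 5 in \<open>simp_all add: transpose_def\<close>)
  next
    case 6 show ?thesis
      by (rule that(6), rule permutes_3_eqI[OF \<rho> perms(2)]) (use 6 in \<open>simp_all add: transpose_def\<close>)
  qed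
qed

lemma swap_cycle: "swap 1 2 \<circ> cycle = swap 1 3" "cycle \<circ> swap 1 2 = swap 2 3"
  "cycle \<circ> (cycle \<circ> cycle) = id" "(cycle \<circ> cycle) \<circ> cycle = id"
  by (rule permutes_3_eqI; (intro permutes_compose permutes_id swap_permutes_3)?;
      simp add: transpose_def)+

section \<open>The generators of Q and the group they generate\<close>

lemma shuffling_inverse_bij:
  assumes "tensor_linear d h" "tensor_linear d h'" and h: "shuffling d \<rho> h"
    and h': "shuffling d \<tau> h'"
    and "\<rho> \<circ> \<tau> = id" "\<tau> \<circ> \<rho> = id"
  shows "bij_betw h (carrier (tensor_space d)) (carrier (tensor_space d))"
proof (rule tensor_linear_bij[OF assms(1,2)])
  have cancel: "g (f (tprod3 (units d I))) = tprod3 (units d I)"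
    if f: "shuffling d \<pi> f" and g: "shuffling d \<chi> g" and id: "\<pi> \<circ> \<chi> = id" for f g \<pi> \<chi> I
  proof -
    have "compose (carrier (tensor_space d)) g f (tprod3 (units d I)) =
        tprod3 (\<lambda>j. transpose_odd (\<pi> \<circ> \<chi>) (units d I ((\<pi> \<circ> \<chi>) j)))"
      using shuffling_compose[OF f g] units_factors[of d I] unfolding shuffling_def by blast
    then show ?thesis by (simp add: compose_eq tprod3_carrier id transpose_odd_def)
  qed
  show "h (h' (tprod3 (units d I))) = tprod3 (units d I)" for I
    by (rule cancel[OF h' h]) fact
  show "h' (h (tprod3 (units d I))) = tprod3 (units d I)" for I
    by (rule cancel[OF h h']) fact
qed

lemma shuffle_Aut:
  assumes "shuffling (mm_shape m n p) \<rho> h" "tensor_linear (mm_shape m n p) h"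
    "bij_betw h (carrier (tensor_space (mm_shape m n p))) (carrier (tensor_space (mm_shape m n p)))"
    and A: "\<And>i j k. i < m \<Longrightarrow> j < n \<Longrightarrow> k < p \<Longrightarrow> h (mm_term m n p i j k) \<in> natural_algorithm m n p"
  shows "h \<in> mm_Aut m n p"
  by (rule algorithm_AutI[OF shuffling_decomposes[OF assms(1-3)] natural_algorithm_is_algorithm])
     (use A in \<open>auto simp: natural_algorithm_def\<close>)

lemma mat_unit_pair_carrier: "mat_unit (a, b) I \<in> carrier_mat a b"
  by (simp add: mat_unit_def)

lemma transpose_mat_unit: "transpose_mat (mat_unit (a, b) (i, j)) = mat_unit (b, a) (j, i)"
  by (rule eq_matI) (auto simp: mat_unit_def)

lemma mm_shape_cyclic:
  fixes n :: nat
  defines "h \<equiv> lin_ext (mm_shape n n n) (\<lambda>x y z. tprod z x y)"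
  shows "shuffling (mm_shape n n n) cycle h" "h \<in> mm_Aut n n n"
proof -
  let ?d = "mm_shape n n n"
  note Q = Q_maps_tprod(1)[where m = n and n = n and p = n, folded h_def]
  have "\<forall>j \<in> {1, 2, 3}. ?d j = ?d (cycle j)" unfolding ball_simps cycle_values by simp
  moreover have "h (tprod3 v) = tprod3 (\<lambda>j. v (cycle j))" if "v \<in> factors ?d" for v
    using that Q[of "v 1" "v 2" "v 3"] unfolding tprod3_def cycle_values
    by (simp add: factors_def module_mat_simps)
  ultimately show sh: "shuffling ?d cycle h"
    using cycle_permutes cycle_even
      by (simp only: shuffling_def transpose_odd_def if_True simp_thms) blast
  have lin: "tensor_linear ?d h"
    unfolding h_def
      by (intro tensor_linear_lin_ext tprod_carrier) (simp_all add: units_def mat_unit_def module_mat_simps)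
  \<comment> \<open>The cycle has order 3, so the square of \<open>h\<close> is its inverse.\<close>
  have bij: "bij_betw h (carrier (tensor_space ?d)) (carrier (tensor_space ?d))"
    by (rule shuffling_inverse_bij[OF lin tensor_linear_compose[OF lin lin] sh shuffling_compose[OF sh sh]])
       (rule swap_cycle)+
  show "h \<in> mm_Aut n n n"
  proof (rule shuffle_Aut[OF sh lin bij])
    fix i j k assume "i < n" "j < n" "k < n"
    then have "h (mm_term n n n i j k) = mm_term n n n k i j"
      unfolding mm_term_def by (subst Q) (simp_all add: mat_unit_pair_carrier)
    then show "h (mm_term n n n i j k) \<in> natural_algorithm n n n"
      using \<open>i < n\<close> \<open>j < n\<close> \<open>k < n\<close> by (auto simp: natural_algorithm_def)
  qed
qed

text \<open>Common part of the three generators that transpose matrices. Such a map is its own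
  inverse, hence bijective.\<close>

lemma mm_shape_swap:
  assumes ab: "a \<in> {1, 2, 3}" "b \<in> {1, 2, 3}" "a \<noteq> b"
    and dim: "\<And>j. j \<in> {1, 2, 3} \<Longrightarrow> mm_shape m n p j = prod.swap (mm_shape m n p (swap a b j))"
    and lin: "tensor_linear (mm_shape m n p) h"
    and val: "\<And>v. v \<in> factors (mm_shape m n p) \<Longrightarrow>
      h (tprod3 v) = tprod3 (\<lambda>j. transpose_mat (v (swap a b j)))"
    and A: "\<And>i j k. i < m \<Longrightarrow> j < n \<Longrightarrow> k < p \<Longrightarrow> h (mm_term m n p i j k) \<in> natural_algorithm m n p"
  shows "shuffling (mm_shape m n p) (swap a b) h" "h \<in> mm_Aut m n p"
proof -
  let ?d = "mm_shape m n p"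
  have odd: "\<not> evenperm (swap a b)" using ab by (simp add: evenperm_swap)
  show sh: "shuffling ?d (swap a b) h"
    unfolding shuffling_def transpose_odd_def using odd swap_permutes_3[OF ab(1,2)] dim val
    by (simp only: if_False simp_thms) blast
  have "bij_betw h (carrier (tensor_space ?d)) (carrier (tensor_space ?d))"
    by (rule shuffling_inverse_bij[OF lin lin sh sh]) (simp_all add: fun_eq_iff)
  then show "h \<in> mm_Aut m n p" by (rule shuffle_Aut[OF sh lin _ A])
qed

lemma mm_shape_swap12:
  fixes m n :: nat
  defines "h \<equiv> lin_ext (mm_shape m n m)
    (\<lambda>x y z. tprod (transpose_mat y) (transpose_mat x) (transpose_mat z))"
  shows "shuffling (mm_shape m n m) (swap 1 2) h \<and> h \<in> mm_Aut m n m"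
proof -
  let ?d = "mm_shape m n m"
  note Q = Q_maps_tprod(2)[where m = m and n = n and p = m, folded h_def]
  have dim: "?d j = prod.swap (?d (swap 1 2 j))" if "j \<in> {1, 2, 3}" for j
    using that by (auto simp: transpose_def)
  have lin: "tensor_linear ?d h"
    unfolding h_def
      by (intro tensor_linear_lin_ext tprod_carrier) (simp_all add: units_def mat_unit_def module_mat_simps)
  have val: "h (tprod3 v) = tprod3 (\<lambda>j. transpose_mat (v (swap 1 2 j)))" if "v \<in> factors ?d" for v
    using that Q[of "v 1" "v 2" "v 3"]
      by (simp add: tprod3_def factors_def module_mat_simps transpose_def)
  have A: "h (mm_term m n m i j k) \<in> natural_algorithm m n m" if "i < m" "j < n" "k < m" for i j k
  proof -
    have "h (mm_term m n m i j k) = mm_term m n m k j i"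
      unfolding mm_term_def by (subst Q) (simp_all add: mat_unit_pair_carrier transpose_mat_unit)
    then show ?thesis using that by (auto simp: natural_algorithm_def)
  qed
  show ?thesis using mm_shape_swap[OF _ _ _ dim lin val A] by simp
qed

lemma mm_shape_swap23:
  fixes m p :: nat
  defines "h \<equiv> lin_ext (mm_shape m m p)
    (\<lambda>x y z. tprod (transpose_mat x) (transpose_mat z) (transpose_mat y))"
  shows "shuffling (mm_shape m m p) (swap 2 3) h \<and> h \<in> mm_Aut m m p"
proof -
  let ?d = "mm_shape m m p"
  note Q = Q_maps_tprod(3)[where m = m and n = m and p = p, folded h_def]
  have dim: "?d j = prod.swap (?d (swap 2 3 j))" if "j \<in> {1, 2, 3}" for j
    using that by (auto simp: transpose_def)
  have lin: "tensor_linear ?d h"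
    unfolding h_def
      by (intro tensor_linear_lin_ext tprod_carrier) (simp_all add: units_def mat_unit_def module_mat_simps)
  have val: "h (tprod3 v) = tprod3 (\<lambda>j. transpose_mat (v (swap 2 3 j)))" if "v \<in> factors ?d" for v
    using that Q[of "v 1" "v 2" "v 3"]
      by (simp add: tprod3_def factors_def module_mat_simps transpose_def)
  have A: "h (mm_term m m p i j k) \<in> natural_algorithm m m p" if "i < m" "j < m" "k < p" for i j k
  proof -
    have "h (mm_term m m p i j k) = mm_term m m p j i k"
      unfolding mm_term_def by (subst Q) (simp_all add: mat_unit_pair_carrier transpose_mat_unit)
    then show ?thesis using that by (auto simp: natural_algorithm_def)
  qed
  show ?thesis using mm_shape_swap[OF _ _ _ dim lin val A] by simp
qed

lemma mm_shape_swap13: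
  fixes m n :: nat
  defines "h \<equiv> lin_ext (mm_shape m n n)
    (\<lambda>x y z. tprod (transpose_mat z) (transpose_mat y) (transpose_mat x))"
  shows "shuffling (mm_shape m n n) (swap 1 3) h \<and> h \<in> mm_Aut m n n"
proof -
  let ?d = "mm_shape m n n"
  note Q = Q_maps_tprod(4)[where m = m and n = n and p = n, folded h_def]
  have dim: "?d j = prod.swap (?d (swap 1 3 j))" if "j \<in> {1, 2, 3}" for j
    using that by (auto simp: transpose_def)
  have lin: "tensor_linear ?d h"
    unfolding h_def
      by (intro tensor_linear_lin_ext tprod_carrier) (simp_all add: units_def mat_unit_def module_mat_simps)
  have val: "h (tprod3 v) = tprod3 (\<lambda>j. transpose_mat (v (swap 1 3 j)))" if "v \<in> factors ?d" for v
    using that Q[of "v 1" "v 2" "v 3"]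
      by (simp add: tprod3_def factors_def module_mat_simps transpose_def)
  have A: "h (mm_term m n n i j k) \<in> natural_algorithm m n n" if "i < m" "j < n" "k < n" for i j k
  proof -
    have "h (mm_term m n n i j k) = mm_term m n n i k j"
      unfolding mm_term_def by (subst Q) (simp_all add: mat_unit_pair_carrier transpose_mat_unit)
    then show ?thesis using that by (auto simp: natural_algorithm_def)
  qed
  show ?thesis using mm_shape_swap[OF _ _ _ dim lin val A] by simp
qed

lemma Q_generators_shuffle:
  assumes "h \<in> Q_generators m n p"
  shows "(\<exists>\<rho>. shuffling (mm_shape m n p) \<rho> h) \<and> h \<in> mm_Aut m n p"
  using assms mm_shape_cyclic[of n] mm_shape_swap12[of m n] mm_shape_swap23[of m p] mm_shape_swap13[of m n]
  unfolding Q_generators_def Let_def by (auto split: if_splits)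

lemma mm_Aut_subgroup: "subgroup (mm_Aut m n p) (mm_isotropy m n p)"
  by (rule algorithm_Aut_subgroup[OF mm_tensor_carrier natural_algorithm_subset])

lemma mm_isotropy_group: "group (mm_isotropy m n p)"
  by (rule isotropy_is_group[OF mm_tensor_carrier])

lemma Q_group_subset_Aut: "Q_group m n p \<subseteq> mm_Aut m n p"
  unfolding Q_group_def
  by (rule group.generate_subgroup_incl[OF mm_isotropy_group _ mm_Aut_subgroup])
     (use Q_generators_shuffle in blast)

lemma Q_group_carrier: "h \<in> Q_group m n p \<Longrightarrow> h \<in> carrier (mm_isotropy m n p)"
  using Q_group_subset_Aut by (auto simp: algorithm_Aut_def)

lemma Q_group_subgroup: "subgroup (Q_group m n p) (mm_isotropy m n p)"
  unfolding Q_group_def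
  by (rule group.generate_is_subgroup[OF mm_isotropy_group])
     (use Q_generators_shuffle in \<open>auto simp: algorithm_Aut_def\<close>)

lemma Q_group_shuffling:
  assumes "h \<in> Q_group m n p"
  shows "\<exists>\<rho>. shuffling (mm_shape m n p) \<rho> h"
  using assms unfolding Q_group_def
proof (induction rule: generate.induct)
  case one
  show ?case unfolding isotropy_group_simps using shuffling_id by blast
next
  case (incl h)
  then show ?case using Q_generators_shuffle by blast
next
  case (inv h)
  then obtain \<rho> where \<rho>: "shuffling (mm_shape m n p) \<rho> h" and h: "h \<in> mm_Aut m n p"
    using Q_generators_shuffle by blast
  then have hG: "h \<in> carrier (mm_isotropy m n p)" by (simp add: algorithm_Aut_def)
  have "bij_betw h (carrier (tensor_space (mm_shape m n p))) (carrier (tensor_space (mm_shape m n p)))"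
    using h by (auto elim!: algorithm_Aut_decomposesE simp: decomposes_def)
  from shuffling_inv[OF \<rho> this] show ?case
    unfolding isotropy_inv[OF mm_tensor_carrier hG] by blast
next
  case (eng h g)
  then obtain \<rho> \<tau> where "shuffling (mm_shape m n p) \<rho> h" "shuffling (mm_shape m n p) \<tau> g" by blast
  from shuffling_compose[OF this(2,1)] show ?case
    using isotropy_mult[of h _ _ g] Q_group_carrier[of h m n p] Q_group_carrier[of g m n p] eng
    by (auto simp: Q_group_def)
qed

text \<open>\<open>h\<close> acts last, so its permutation is applied first when the source of a
  position is traced back.\<close>

lemma Q_group_mult_shuffling:
  assumes h: "h \<in> Q_group m n p" "shuffling (mm_shape m n p) \<rho> h"
    and g: "g \<in> Q_group m n p" "shuffling (mm_shape m n p) \<tau> g"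
  shows "\<exists>f \<in> Q_group m n p. shuffling (mm_shape m n p) (\<tau> \<circ> \<rho>) f"
proof
  show "shuffling (mm_shape m n p) (\<tau> \<circ> \<rho>) (h \<otimes>\<^bsub>mm_isotropy m n p\<^esub> g)"
    using shuffling_compose[OF g(2) h(2)]
    by (simp only: isotropy_mult[OF Q_group_carrier[OF h(1)] Q_group_carrier[OF g(1)]])
  show "h \<otimes>\<^bsub>mm_isotropy m n p\<^esub> g \<in> Q_group m n p"
    by (rule subgroup.m_closed[OF Q_group_subgroup h(1) g(1)])
qed

section \<open>Permutations of the factors that occur, and the trivial intersection\<close>

lemma card_positions_mm_shape:
  "card (positions (mm_shape m n p 1)) = m * n" "card (positions (mm_shape m n p 2)) = n * p"
  "card (positions (mm_shape m n p 3)) = p * m"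
  by (simp_all add: positions_def)

text \<open>For three equal sizes the generators produce every permutation. Otherwise dimensions
  exclude what Q does not contain: exchanging two factors forces their dimensions to agree, and
  cancelling the size they share makes the other two sizes equal, so the matching generator is
  available. A 3-cycle forces mn = np = pm, hence m = n = p.\<close>

lemma Q_group_realizes:
  assumes pos: "m > 0" "n > 0" "p > 0"
    and g: "g \<in> mm_Aut m n p" "decomposes (mm_shape m n p) \<rho> \<phi> g"
  shows "\<exists>h \<in> Q_group m n p. shuffling (mm_shape m n p) \<rho> h"
proof -
  let ?Q = "Q_group m n p" and ?d = "mm_shape m n p"
  have gen: "h \<in> ?Q" if "h \<in> Q_generators m n p" for h
    unfolding Q_group_def using that by (rule generate.incl)
  have \<rho>: "\<rho> permutes {1, 2, 3}" using g(2) by (simp add: decomposes_def)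
  note le = mm_Aut_card_le[OF g pos, of 1] mm_Aut_card_le[OF g pos, of 2] mm_Aut_card_le[OF g pos, of 3]
  have one: "\<exists>h \<in> ?Q. shuffling ?d id h"
    using subgroup.one_closed[OF Q_group_subgroup] shuffling_id[of ?d]
    by (auto simp: isotropy_group_simps)
  have all: ?thesis if eq: "m = n" "n = p"
  proof -
    obtain r where r: "r \<in> ?Q" "shuffling ?d cycle r"
      using mm_shape_cyclic(1)[of n] eq gen by (auto simp: Q_generators_def Let_def)
    obtain t where t: "t \<in> ?Q" "shuffling ?d (swap 1 2) t"
      using mm_shape_swap12[of m n] eq gen by (auto simp: Q_generators_def Let_def)
    show ?thesis
      using \<rho>
    proof (cases rule: permutes_3_cases)
      case 1 then show ?thesis using one by simp
    next
      case 2 then show ?thesis using t by blast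
    next
      case 3 then show ?thesis using Q_group_mult_shuffling[OF r t] by (simp only: swap_cycle)
    next
      case 4 then show ?thesis using Q_group_mult_shuffling[OF t r] by (simp only: swap_cycle)
    next
      case 5 then show ?thesis using r by blast
    next
      case 6 then show ?thesis using Q_group_mult_shuffling[OF r r] by simp
    qed
  qed
  show ?thesis
  proof (cases "m = n \<and> n = p")
    case True then show ?thesis using all by blast
  next
    case False
    have c: "card (positions (?d (Suc 0))) = m * n" "card (positions (?d 2)) = n * p"
      "card (positions (?d 3)) = p * m" using card_positions_mm_shape by simp_all
    show ?thesis
      using \<rho>
    proof (cases rule: permutes_3_cases)
      case 1 then show ?thesis using one by simp
    next
      case 2
      then have "n * p = m * n" using le c by (auto simp: transpose_def)
      then have eq: "m = p" using pos by auto
      then show ?thesis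
        using mm_shape_swap12[of m n] gen False 2 by (auto simp: Q_generators_def Let_def)
    next
      case 3
      then have "p * m = m * n" using le c by (auto simp: transpose_def)
      then have eq: "n = p" using pos by auto
      then show ?thesis
        using mm_shape_swap13[of m n] gen False 3 by (auto simp: Q_generators_def Let_def)
    next
      case 4
      then have "p * m = n * p" using le c by (auto simp: transpose_def)
      then have eq: "m = n" using pos by auto
      then show ?thesis
        using mm_shape_swap23[of m p] gen False 4 by (auto simp: Q_generators_def Let_def)
    next
      case 5
      then have "p * m \<le> m * n" "m * n \<le> n * p" "n * p \<le> p * m" using le c
        by (simp_all add: transpose_def)
      then have "m * n = n * p" "n * p = p * m" by linarith+
      then show ?thesis using pos False by simp
    next
      case 6
      then have "n * p \<le> m * n" "p * m \<le> n * p" "m * n \<le> p * m" using le c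
        by (simp_all add: transpose_def)
      then have "m * n = n * p" "n * p = p * m" by linarith+
      then show ?thesis using pos False by simp
    qed
  qed
qed

text \<open>If \<open>\<rho>\<close> moved a factor, the image in some slot would depend on the
  input of another slot by the shuffle description, but only on its own input by the factorwise one.
  Varying the former input within a space of dimension at least 2 gives a contradiction. In
  dimension 1 nothing can be varied, and that case is settled directly.\<close>

lemma shuffle_factorwise_trivial:
  assumes pos: "m > 0" "n > 0" "p > 0"
    and h: "shuffling (mm_shape m n p) \<rho> h" "decomposes (mm_shape m n p) id \<phi> h" "h \<in> mm_Aut m n p"
  shows "h = (\<lambda>x \<in> carrier (tensor_space (mm_shape m n p)). x)"
proof -
  let ?d = "mm_shape m n p"
  have lin: "tensor_linear ?d h" using h(2) by (simp add: decomposes_def)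
  have \<rho>: "\<rho> permutes {1, 2, 3}" using h(1) by (simp add: shuffling_def)
  have trivial: ?thesis if "\<And>I. I \<in> indices ?d \<Longrightarrow> h (tprod3 (units ?d I)) = tprod3 (units ?d I)"
    by (rule tensor_linear_eqI[OF lin tensor_linear_id]) (use that in \<open>simp add: tprod3_carrier\<close>)
  show ?thesis
  \<comment> \<open>With all sizes 1 there is a single term, which spans the space and is fixed;
    \<open>\<rho>\<close> may then be any permutation.\<close>
  proof (cases "m = 1 \<and> n = 1 \<and> p = 1")
    case True
    then have A: "natural_algorithm m n p = {mm_term m n p 0 0 0}"
      by (auto simp: natural_algorithm_def)
    have "h ` natural_algorithm m n p = natural_algorithm m n p" using h(3)
      by (simp add: algorithm_Aut_def)
    then have "h (mm_term m n p 0 0 0) = mm_term m n p 0 0 0" by (simp add: A)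
    moreover have "tprod3 (units ?d I) = mm_term m n p 0 0 0" if "I \<in> indices ?d" for I
    proof -
      have "I 1 = (0, 0)" "I 2 = (0, 0)" "I 3 = (0, 0)"
        using that True by (auto simp: indices_def positions_def prod_eq_iff)
      then show ?thesis unfolding mm_term_units by (intro tprod3_cong) (auto simp: units_def)
    qed
    ultimately show ?thesis by (intro trivial) simp
  next
    case False
    show ?thesis
    proof (cases "\<rho> = id")
      case True
      then have "h (tprod3 v) = tprod3 v" if "v \<in> factors ?d" for v
        using h(1) that by (simp add: shuffling_def transpose_odd_def)
      then show ?thesis by (intro trivial) simp
    next
      case nid: False
      \<comment> \<open>Any two of the three shapes involve all three sizes, so they cannot both
        have dimension 1. A nontrivial \<open>\<rho>\<close> moves at least two slots, and
        \<open>\<rho> l\<close> runs through the moved ones.\<close>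
      have big: "m * n \<ge> 2 \<or> n * p \<ge> 2" "n * p \<ge> 2 \<or> p * m \<ge> 2" "m * n \<ge> 2 \<or> p * m \<ge> 2"
      proof -
        have "a * b \<ge> 2 \<or> b * c \<ge> 2" if "a > 0" "b > 0" "c > 0" "\<not> (a = 1 \<and> b = 1 \<and> c = 1)"
          for a b c :: nat
        proof (rule ccontr)
          assume "\<not> (a * b \<ge> 2 \<or> b * c \<ge> 2)"
          moreover have "a * b > 0" "b * c > 0" using that by simp_all
          ultimately have "a * b = 1" "b * c = 1" by linarith+
          then show False using that(4) by simp
        qed
        from this[of m n p] this[of n p m] this[of p m n] show
          "m * n \<ge> 2 \<or> n * p \<ge> 2" "n * p \<ge> 2 \<or> p * m \<ge> 2" "m * n \<ge> 2 \<or> p * m \<ge> 2"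
          using pos False by auto
      qed
      have "\<exists>l \<in> {1, 2, 3}. \<rho> l \<noteq> l \<and> card (positions (?d (\<rho> l))) \<ge> 2"
        using \<rho>
      proof (cases rule: permutes_3_cases)
        case 1 then show ?thesis using nid by simp
      qed (use big card_positions_mm_shape[of m n p] in \<open>auto simp: transpose_def\<close>)
      then obtain l where l: "l \<in> {1, 2, 3}" "\<rho> l \<noteq> l" "card (positions (?d (\<rho> l))) \<ge> 2" by blast
      then obtain X Y where XY: "X \<in> positions (?d (\<rho> l))" "Y \<in> positions (?d (\<rho> l))" "X \<noteq> Y"
        using card_le_Suc0_iff_eq[of "positions (?d (\<rho> l))"] by fastforce
      define I\<^sub>0 where "I\<^sub>0 = mm_index 0 0 0"
      have I\<^sub>0: "I\<^sub>0 \<in> indices ?d" using pos by (simp add: I\<^sub>0_def)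
      have dl: "?d l = (if evenperm \<rho> then ?d (\<rho> l) else prod.swap (?d (\<rho> l)))"
        using h(1) l(1) unfolding shuffling_def by blast
      \<comment> \<open>The effect of the shuffle on the index of a matrix unit.\<close>
      define t where "t x = (if evenperm \<rho> then x else prod.swap x)" for x :: "nat \<times> nat"
      have t: "t x \<in> positions (?d j)" "transpose_odd \<rho> (mat_unit (?d (\<rho> j)) x) = mat_unit (?d j) (t x)"
        if j: "j \<in> {1, 2, 3}" and x: "x \<in> positions (?d (\<rho> j))" for x j
      proof -
        have dj: "?d j = (if evenperm \<rho> then ?d (\<rho> j) else prod.swap (?d (\<rho> j)))"
          using h(1) j unfolding shuffling_def by blast
        obtain a b u w where "?d (\<rho> j) = (a, b)" "x = (u, w)" by fastforce
        then show "t x \<in> positions (?d j)"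
          "transpose_odd \<rho> (mat_unit (?d (\<rho> j)) x) = mat_unit (?d j) (t x)"
          using dj x by (simp_all add: t_def transpose_odd_def transpose_mat_unit positions_def)
      qed
      \<comment> \<open>Only slot \<open>\<rho> l\<close> of the base triple is changed to
        \<open>Z\<close>. Slot \<open>l\<close> keeps its input because
        \<open>\<rho> l \<noteq> l\<close>, whereas the shuffle puts the unit belonging to
        \<open>Z\<close> there.\<close>
      have image: "\<exists>c. c \<noteq> 0 \<and> \<phi> l (mat_unit (?d l) (I\<^sub>0 l)) = c \<cdot>\<^sub>m mat_unit (?d l) (t Z)"
        if Z: "Z \<in> positions (?d (\<rho> l))" for Z
      proof -
        let ?I = "I\<^sub>0(\<rho> l := Z)"
        have I: "?I \<in> indices ?d"
          unfolding indices_def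
        proof (rule CollectI, rule ballI)
          fix i :: nat assume "i \<in> {1, 2, 3}"
          then have "I\<^sub>0 i \<in> positions (?d i)" using I\<^sub>0 unfolding indices_def by blast
          then show "?I i \<in> positions (?d i)" using Z by (cases "i = \<rho> l") simp_all
        qed
        have I': "(\<lambda>j. t (?I (\<rho> j))) \<in> indices ?d"
          unfolding indices_def
        proof (rule CollectI, rule ballI)
          fix j :: nat assume j: "j \<in> {1, 2, 3}"
          have "?I (\<rho> j) \<in> positions (?d (\<rho> j))"
            using I permutes_3[OF \<rho> j] unfolding indices_def by blast
          then show "t (?I (\<rho> j)) \<in> positions (?d j)" by (rule t(1)[OF j])
        qed
        have "tprod3 (\<lambda>j. \<phi> j (units ?d ?I j)) = h (tprod3 (units ?d ?I))"
          using h(2) by (simp add: decomposes_def)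
        also have "\<dots> = tprod3 (\<lambda>j. transpose_odd \<rho> (units ?d ?I (\<rho> j)))"
          using h(1) units_factors[of ?d ?I] unfolding shuffling_def by blast
        also have "\<dots> = tprod3 (units ?d (\<lambda>j. t (?I (\<rho> j))))"
        proof (rule tprod3_cong)
          fix j :: nat assume j: "j \<in> {1, 2, 3}"
          have "?I (\<rho> j) \<in> positions (?d (\<rho> j))"
            using I permutes_3[OF \<rho> j] unfolding indices_def by blast
          then show "transpose_odd \<rho> (units ?d ?I (\<rho> j)) = units ?d (\<lambda>j. t (?I (\<rho> j))) j"
            unfolding units_def by (rule t(2)[OF j])
        qed
        finally have eq: "tprod3 (\<lambda>j. \<phi> j (units ?d ?I j)) = tprod3 (units ?d (\<lambda>j. t (?I (\<rho> j))))" .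
        have fac: "(\<lambda>j. \<phi> j (units ?d ?I j)) \<in> factors ?d"
          using decomposes_factors[OF h(2) units_factors[of ?d ?I]] by simp
        obtain c where "c l \<noteq> 0 \<and> \<phi> l (units ?d ?I l) = c l \<cdot>\<^sub>m units ?d (\<lambda>j. t (?I (\<rho> j))) l"
          by (rule tprod3_eq_unitsE[OF eq fac I']) (use l(1) in blast)
        then show ?thesis using l(2) by (auto simp: units_def)
      qed
      \<comment> \<open>Both sides are the image under \<open>\<phi> l\<close> of the same unit, so
        the two choices of \<open>Z\<close> cannot differ.\<close>
      obtain c1 c2 where c: "c1 \<noteq> 0" "c1 \<cdot>\<^sub>m mat_unit (?d l) (t X) = c2 \<cdot>\<^sub>m mat_unit (?d l) (t Y)"
        using image[OF XY(1)] image[OF XY(2)] by metis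
      have "t X = t Y" by (rule smult_unit_eqD[OF c(2,1) t(1)[OF l(1) XY(1)] t(1)[OF l(1) XY(2)]])
      then have "X = Y" by (simp add: t_def prod_eq_iff split: if_splits)
      then show ?thesis using XY(3) by simp
    qed
  qed
qed

theorem corollary3p16:
  fixes m n p :: nat
  assumes "m > 0" and "n > 0" and "p > 0"
  shows "internal_semidirect (mm_isotropy m n p)
    (algorithm_Aut (mm_shape m n p) (mm_tensor m n p) (natural_algorithm m n p))
    (gen_perm_subgroup m n p) (Q_group m n p)"
proof -
  let ?G = "mm_isotropy m n p" and ?K = "mm_Aut m n p" and ?N = "gen_perm_subgroup m n p"
    and ?H = "Q_group m n p"
  note N = gen_perm_subgroup_eq_factorwise[OF assms]
  interpret group ?G by (rule mm_isotropy_group)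
  have NK: "?N \<subseteq> ?K" unfolding N factorwise_def by blast
  have normal: "?N \<lhd> ?G\<lparr>carrier := ?K\<rparr>"
    unfolding N by (rule factorwise_normal[OF mm_tensor_carrier natural_algorithm_subset])
  have HK: "subgroup ?H (?G\<lparr>carrier := ?K\<rparr>)"
    by (rule subgroup_incl[OF Q_group_subgroup mm_Aut_subgroup Q_group_subset_Aut])
  have "\<one>\<^bsub>?G\<^esub> \<in> ?N"
    using normal_imp_subgroup[OF normal] subgroup.one_closed by fastforce
  moreover have "\<one>\<^bsub>?G\<^esub> \<in> ?H" by (rule subgroup.one_closed[OF Q_group_subgroup])
  moreover have "h = \<one>\<^bsub>?G\<^esub>" if "h \<in> ?N" "h \<in> ?H" for h
  proof -
    obtain \<phi> where "h \<in> ?K" "decomposes (mm_shape m n p) id \<phi> h"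
      using \<open>h \<in> ?N\<close> unfolding N factorwise_def by blast
    moreover obtain \<rho> where "shuffling (mm_shape m n p) \<rho> h"
      using Q_group_shuffling[OF \<open>h \<in> ?H\<close>] by blast
    ultimately show ?thesis
      using shuffle_factorwise_trivial[OF assms] by (simp add: isotropy_group_simps)
  qed
  ultimately have inter: "?N \<inter> ?H = {\<one>\<^bsub>?G\<^esub>}" by blast
  have "?K = ?N <#>\<^bsub>?G\<^esub> ?H"
  proof
    show "?N <#>\<^bsub>?G\<^esub> ?H \<subseteq> ?K"
      using NK Q_group_subset_Aut[of m n p] subgroup.m_closed[OF mm_Aut_subgroup[of m n p]]
      unfolding set_mult_def by blast
    show "?K \<subseteq> ?N <#>\<^bsub>?G\<^esub> ?H"
    proof
      fix g assume g: "g \<in> ?K"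
      then obtain \<rho> \<phi> where dg: "decomposes (mm_shape m n p) \<rho> \<phi> g"
        by (rule algorithm_Aut_decomposesE)
      obtain h where h: "h \<in> ?H" "shuffling (mm_shape m n p) \<rho> h"
        using Q_group_realizes[OF assms g dg] by blast
      have hK: "h \<in> ?K" using h(1) Q_group_subset_Aut by blast
      \<comment> \<open>Being a shuffle says nothing about tensors that are not decomposable;
        linearity and bijectivity are taken from membership in the automorphism group.\<close>
      have "tensor_linear (mm_shape m n p) h"
        "bij_betw h (carrier (tensor_space (mm_shape m n p))) (carrier (tensor_space (mm_shape m n p)))"
        using hK by (auto elim!: algorithm_Aut_decomposesE simp: decomposes_def)
      note dh = shuffling_decomposes[OF h(2) this]
      have gN: "g \<otimes>\<^bsub>?G\<^esub> inv\<^bsub>?G\<^esub> h \<in> ?N"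
        unfolding N
          by (rule factorwise_quotient[OF mm_tensor_carrier natural_algorithm_subset g dg hK dh])
      have "g \<in> carrier ?G" "h \<in> carrier ?G"
        using g hK subgroup.mem_carrier[OF mm_Aut_subgroup] by blast+
      then have "g = (g \<otimes>\<^bsub>?G\<^esub> inv\<^bsub>?G\<^esub> h) \<otimes>\<^bsub>?G\<^esub> h" by (simp add: m_assoc)
      then show "g \<in> ?N <#>\<^bsub>?G\<^esub> ?H" unfolding set_mult_def using gN h(1) by blast
    qed
  qed
  then show ?thesis
    unfolding internal_semidirect_def
    using is_group mm_Aut_subgroup normal HK inter by blast
qed

end
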